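(* Let $d\in\mathbb{N}$, $\Omega\subset\mathbb{R}^d$, $\tau>d/2$ and $\sigma\in(\frac{d}{2\tau},1]$. Let $k(x,z)=\Phi(x-z)$ and $k^{(\sigma)}(x,z)=\Phi^{(\sigma)}(x-z)$ be the translational invariant kernels with $$\hat\Phi(\omega)=(1+\Vert\omega\Vert^2)^{-\tau},\qquad \hat\Phi^{(\sigma)}(\omega)=(1+\Vert\omega\Vert^2)^{-\sigma\tau}\qquad\text{for all }\omega\in\mathbb{R}^d .$$ Then there is a constant $c_\sigma>0$, depending only on $\sigma,d,\tau,\Omega$, such that for every finite set $X\subset\Omega$ of pairwise distinct points, the kernel matrices $A=k(X,X)$ and $A^{(\sigma)}=k^{(\sigma)}(X,X)$ satisfy, for all $0\ne\alpha\in\mathbb{R}^{|X|}$, $$\frac{\alpha^\top A\alpha}{\Vert\alpha\Vert^2}\ \le\ \frac{\alpha^\top A^{(\sigma)}\alpha}{\Vert\alpha\Vert^2}\ \le\ c_\sigma\left(q_X^{2}+c_0^2\right)^{(1-\sigma)\tau}q_X^{-(1-\sigma)2\tau}\cdot\frac{\alpha^\top A\alpha}{\Vert\alpha\Vert^2},$$ where $c_0>0$ is the constant defined in the context, depending only on $d$. If $\Omega$ is bounded, then there is a constant $c_\sigma'>0$, depending only on $\sigma,d,\tau,\Omega$, such that for every such $X$ and all $0\ne\alpha\in\mathbb{R}^{|X|}$, $$\frac{\alpha^\top A\alpha}{\Vert\alpha\Vert^2}\ \le\ \frac{\alpha^\top A^{(\sigma)}\alpha}{\Vert\alpha\Vert^2}\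 \le\ c_\sigma'\,q_X^{-(1-\sigma)2\tau}\cdot\frac{\alpha^\top A\alpha}{\Vert\alpha\Vert^2}.$$
   Context: The kernel matrix of $k$ on $X=\{x_1,\dots,x_{|X|}\}$ is $k(X,X)=(k(x_i,x_j))_{i,j}$. The separation distance of $X$ (with at least two points) is $q_X:=\min_{x_i\ne x_j\in X}\Vert x_i-x_j\Vert$, with $\Vert\cdot\Vert$ the Euclidean norm. A function $\Phi$ and its Fourier transform $\hat\Phi$ are related by $\Phi(x)=(2\pi)^{-d/2}\int_{\mathbb{R}^d}\hat\Phi(\omega)e^{i\omega^\top x}\,\mathrm{d}\omega$ for all $x\in\mathbb{R}^d$. The constant $c_0$ is $c_0:=\sqrt2\,\lambda_{\min}^{1/2}(-\Delta)$, where $\lambda_{\min}(-\Delta)$ is the smallest eigenvalue of the Dirichlet Laplace operator on the ball of radius $1/2$ around the origin in $\mathbb{R}^d$. *)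

theory Defs
  imports "HOL-Analysis.Analysis" "Jordan_Normal_Form.Matrix"
begin

text \<open>
  Points of Euclidean space have the type \<open>real^'d\<close>, of dimension \<open>CARD('d)\<close>. Kernel matrices and
  coefficient vectors have a size that varies inside the theorem, so they are \<open>real mat\<close> and
  \<open>real vec\<close>. Both libraries use the same infix symbol for their inner products; the prefix
  names \<open>inner\<close> (on \<open>real^'d\<close>) and \<open>scalar_prod\<close> (on \<open>real vec\<close>) are used below.
\<close>

subsection \<open>Kernel matrices, quadratic forms, separation distance\<close>

definition kernel_matrix :: "('a \<Rightarrow> 'a \<Rightarrow> real) \<Rightarrow> 'a list \<Rightarrow> real mat" where
  "kernel_matrix k xs = mat (length xs) (length xs) (\<lambda>(i, j). k (xs ! i) (xs ! j))"

text \<open>The denominator is the squared Euclidean norm of \<open>\<alpha>\<close>.\<close>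

definition rayleigh_quotient :: "real mat \<Rightarrow> real vec \<Rightarrow> real" where
  "rayleigh_quotient A \<alpha> = scalar_prod \<alpha> (A *\<^sub>v \<alpha>) / scalar_prod \<alpha> \<alpha>"

text \<open>Only meaningful for finite sets with at least two points.\<close>

definition separation_distance :: "'a::real_normed_vector set \<Rightarrow> real" where
  "separation_distance X = Min {norm (x - z) | x z. x \<in> X \<and> z \<in> X \<and> x \<noteq> z}"


subsection \<open>Fourier transform\<close>

text \<open>\<open>\<Phi>\<close> has the (real-valued) Fourier transform \<open>\<Phi>hat\<close>, in the unitary normalization.
  Both functions are real-valued, but the integrand is complex.\<close>

definition has_fourier_transform :: "(real^'d \<Rightarrow> real) \<Rightarrow> (real^'d \<Rightarrow> real) \<Rightarrow> bool" where
  "has_fourier_transform \<Phi> \<Phi>hat \<longleftrightarrow>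
     (\<forall>x. complex_of_real (\<Phi> x) =
        complex_of_real ((2 * pi) powr (- (real CARD('d) / 2))) *
        (LINT \<omega>|lborel. complex_of_real (\<Phi>hat \<omega>) * exp (\<i> * complex_of_real (inner \<omega> x))))"


subsection \<open>Dirichlet eigenvalues of the Laplacian\<close>

definition partial_deriv :: "'a::euclidean_space \<Rightarrow> ('a \<Rightarrow> real) \<Rightarrow> 'a \<Rightarrow> real" where
  "partial_deriv b f x = deriv (\<lambda>t. f (x + t *\<^sub>R b)) 0"

text \<open>Continuous differentiability of first and second order, via existence and continuity of the
  partial derivatives. These notions are intended for open sets only.\<close>

definition C1_on :: "'a::euclidean_space set \<Rightarrow> ('a \<Rightarrow> real) \<Rightarrow> bool" where
  "C1_on S f \<longleftrightarrow>
     (\<forall>b\<in>Basis. (\<forall>x\<in>S. (\<lambda>t. f (x + t *\<^sub>R b)) differentiable (at (0::real))) \<and>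
                continuous_on S (partial_deriv b f))"

definition C2_on :: "'a::euclidean_space set \<Rightarrow> ('a \<Rightarrow> real) \<Rightarrow> bool" where
  "C2_on S f \<longleftrightarrow> C1_on S f \<and> (\<forall>b\<in>Basis. C1_on S (partial_deriv b f))"

definition laplacian :: "('a::euclidean_space \<Rightarrow> real) \<Rightarrow> 'a \<Rightarrow> real" where
  "laplacian f x = (\<Sum>b\<in>Basis. partial_deriv b (partial_deriv b f) x)"

text \<open>\<open>\<mu>\<close> is an eigenvalue of \<open>-\<Delta>\<close> on the open set \<open>S\<close> with zero boundary values.
  On a ball, classical eigenfunctions in this sense are the same as weak ones,
  and all eigenvalues are real.\<close>

definition dirichlet_eigenvalue :: "'a::euclidean_space set \<Rightarrow> real \<Rightarrow> bool" where
  "dirichlet_eigenvalue S \<mu> \<longleftrightarrow>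
     (\<exists>u. C2_on S u \<and> continuous_on (closure S) u \<and>
          (\<forall>x\<in>frontier S. u x = 0) \<and> (\<exists>x\<in>S. u x \<noteq> 0) \<and>
          (\<forall>x\<in>S. - laplacian u x = \<mu> * u x))"

definition dirichlet_lambda_min :: "'a::euclidean_space set \<Rightarrow> real" where
  "dirichlet_lambda_min S = (LEAST \<mu>. dirichlet_eigenvalue S \<mu>)"

definition c0 :: "'d::finite itself \<Rightarrow> real" where
  "c0 _ = sqrt 2 * sqrt (dirichlet_lambda_min (ball (0 :: real^'d) (1/2)))"

end

theory Submission
  imports Defs "HOL-Probability.Characteristic_Functions"
begin

text \<open>
  Write \<open>P \<omega>\<close> for the squared modulus of \<open>\<Sum>j. \<alpha> j * exp (\<i> * (\<omega> \<bullet> x j))\<close>. By the Fourier representation of the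
  kernels, the two quadratic forms are, up to a common factor, the integrals of \<open>P\<close> against
  \<open>(1 + |\<omega>|\<^sup>2) powr - \<tau>\<close> and \<open>(1 + |\<omega>|\<^sup>2) powr - (\<sigma> * \<tau>)\<close>. The lower inequality
  compares these symbols pointwise (\<open>bessel_form_antimono\<close>).

  For the upper inequality, Gamma's integral expresses each symbol as a superposition of Gaussians
  \<open>exp (- t |\<omega>|\<^sup>2)\<close> in which the exponent enters only through the weight in \<open>t\<close>
  (\<open>bessel_symbol_as_gaussian_mixture\<close>). The integral of \<open>P\<close> against such a Gaussian is a quadratic form in the
  matrix of the numbers \<open>exp (- |x i - x j|\<^sup>2 / (4 t))\<close>. When \<open>t\<close> is below a small multiple \<open>t0\<close> of the
  squared separation distance, a packing argument shows that this matrix is diagonally dominant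
  (\<open>gaussian_sum_le_half\<close>), so that the integral is comparable to \<open>t powr - (d/2)\<close> times the squared norm of the
  coefficients. The part \<open>t > t0\<close> of the two mixtures is compared through the weights, the part \<open>t \<le> t0\<close>
  by explicit integration, and both give the factor \<open>t0 powr - ((1 - \<sigma>) * \<tau>)\<close>
  (\<open>gamma_weighted_comparison\<close>, \<open>bessel_form_comparison\<close>). Using \<open>min q 1\<close> for the separation distance
  makes the argument uniform, and the resulting factor is at most a multiple of
  \<open>((q\<^sup>2 + c\<^sup>2) / q\<^sup>2) powr ((1 - \<sigma>) * \<tau>)\<close> for any fixed \<open>c > 0\<close>; on a bounded domain \<open>q\<close> is
  bounded by the diameter.

  It remains to see that \<open>c0\<close> is positive, which requires that a least Dirichlet eigenvalue exists. The radial
  solution of \<open>- \<Delta> w = \<mu> w\<close> is a power series in \<open>\<mu> |x|\<^sup>2\<close>, its first zero yields an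
  eigenfunction on the ball, and a maximum principle for quotients (\<open>dirichlet_comparison\<close>) shows both that a zero
  exists and that no eigenvalue is smaller (\<open>dirichlet_lambda_min_ball_pos\<close>).
\<close>

section \<open>A comparison principle for Dirichlet eigenvalues\<close>

lemma second_derivative_nonpos_at_local_max:
  fixes h h' :: "real \<Rightarrow> real"
  assumes e: "e > 0"
    and h': "\<And>t. \<bar>t\<bar> < e \<Longrightarrow> (h has_real_derivative h' t) (at t)"
    and h2: "(h' has_real_derivative c) (at 0)"
    and max: "\<And>t. \<bar>t\<bar> < e \<Longrightarrow> h t \<le> h 0"
  shows "c \<le> 0"
proof (rule ccontr)
  assume "\<not> c \<le> 0"
  have h'0: "h' 0 = 0"
    using DERIV_local_max[OF h'[of 0] e] max e by simp
  obtain d where d: "d > 0" "\<And>s. 0 < s \<Longrightarrow> s < d \<Longrightarrow> h' 0 < h' s"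
    using DERIV_pos_inc_right[OF h2] \<open>\<not> c \<le> 0\<close> by force
  define s where "s = min d e / 2"
  have s: "0 < s" "s < d" "s < e" using d e by (auto simp: s_def)
  obtain z where z: "0 < z" "z < s" "h s - h 0 = (s - 0) * h' z"
    using MVT2[of 0 s h h'] h' s by auto
  have "h' z > 0" using d(2)[of z] z s h'0 by auto
  then have "h s > h 0" using z s by (smt (verit) mult_pos_pos)
  then show False using max[of s] s by auto
qed

text \<open>
  Partial derivatives are defined at \<open>t = 0\<close> only. Translating the base point gives the derivative along a whole
  segment, as the one-dimensional second derivative test requires.
\<close>

lemma C1_on_DERIV:
  assumes "C1_on S f" "b \<in> Basis" "x + s *\<^sub>R b \<in> S"
  shows "((\<lambda>t. f (x + t *\<^sub>R b)) has_real_derivative partial_deriv b f (x + s *\<^sub>R b)) (at s)"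
proof -
  have "((\<lambda>t. f (x + s *\<^sub>R b + t *\<^sub>R b)) has_real_derivative partial_deriv b f (x + s *\<^sub>R b)) (at 0)"
    using assms unfolding C1_on_def partial_deriv_def
    by (simp add: DERIV_deriv_iff_real_differentiable)
  then have "((\<lambda>t. f (x + (s + t) *\<^sub>R b)) has_real_derivative partial_deriv b f (x + s *\<^sub>R b)) (at 0)"
    by (simp add: algebra_simps)
  then show ?thesis
    using DERIV_shift[of "\<lambda>t. f (x + t *\<^sub>R b)" "partial_deriv b f (x + s *\<^sub>R b)" 0 s]
    by (simp add: add.commute)
qed

text \<open>
  The maximum principle for the quotient \<open>v / w\<close> of a subsolution for \<open>\<nu>\<close> by a positive supersolution
  for \<open>\<mu>\<close> (Barta's inequality): at an interior maximum \<open>x0\<close> of \<open>a v / w\<close>, with value \<open>M > 0\<close>, the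
  function \<open>a v - M w\<close> has a maximum equal to \<open>0\<close>, so its Laplacian is not positive there, and this
  reads \<open>\<mu> M w x0 \<le> \<nu> M w x0\<close>. The maximum principle suits eigenfunctions that are merely
  continuous up to the boundary, where an integration by parts would be out of place. The factor \<open>a\<close> serves to replace an
  eigenfunction by its negative.
\<close>

lemma dirichlet_comparison:
  fixes v w :: "'a::euclidean_space \<Rightarrow> real"
  assumes K: "compact K" "open S" "S \<subseteq> K"
    and v: "C2_on S v" "continuous_on K v" "\<And>x. x \<in> K - S \<Longrightarrow> v x = 0"
    and v_sub: "\<And>x. x \<in> S \<Longrightarrow> a * v x > 0 \<Longrightarrow> - (a * laplacian v x) \<le> \<nu> * (a * v x)"
    and x1: "x1 \<in> S" "a * v x1 > 0"
    and w: "C2_on S w" "continuous_on K w" "\<And>x. x \<in> K \<Longrightarrow> w x > 0"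
    and w_super: "\<And>x. x \<in> S \<Longrightarrow> - laplacian w x \<ge> \<mu> * w x"
  shows "\<mu> \<le> \<nu>"
proof -
  have "continuous_on K (\<lambda>x. a * v x / w x)"
    using v w by (intro continuous_intros) fastforce+
  then obtain x0 where x0: "x0 \<in> K" "\<And>y. y \<in> K \<Longrightarrow> a * v y / w y \<le> a * v x0 / w x0"
    using continuous_attains_sup[of K "\<lambda>x. a * v x / w x"] K x1 by blast
  define M where "M = a * v x0 / w x0"
  have M: "M > 0"
    using x0(2)[of x1] w(3)[of x1] x1 K unfolding M_def
    by (meson divide_pos_pos order_less_le_trans subsetD)
  have x0S: "x0 \<in> S"
    using v(3)[of x0] x0(1) M unfolding M_def by fastforce
  have vx0: "a * v x0 = M * w x0"
    using w(3)[OF x0(1)] by (simp add: M_def)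
  have below: "a * v y \<le> M * w y" if "y \<in> K" for y
    using x0(2)[OF that] w(3)[OF that] by (simp add: M_def pos_divide_le_eq)
  obtain e where e: "e > 0" "ball x0 e \<subseteq> S"
    using K x0S by (meson open_contains_ball)
  have dir: "a * partial_deriv b (partial_deriv b v) x0 - M * partial_deriv b (partial_deriv b w) x0 \<le> 0"
    if b: "b \<in> Basis" for b
  proof -
    have inS: "x0 + t *\<^sub>R b \<in> S" if "\<bar>t\<bar> < e" for t
      using e that b by (auto simp: subset_eq dist_norm)
    have D1: "((\<lambda>t. a * v (x0 + t *\<^sub>R b) - M * w (x0 + t *\<^sub>R b)) has_real_derivative
        a * partial_deriv b v (x0 + t *\<^sub>R b) - M * partial_deriv b w (x0 + t *\<^sub>R b)) (at t)"
      if "\<bar>t\<bar> < e" for t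
      using v(1) w(1) b inS[OF that] unfolding C2_on_def
      by (intro DERIV_diff DERIV_cmult C1_on_DERIV[of S]) auto
    have "((\<lambda>t. a * partial_deriv b v (x0 + t *\<^sub>R b) - M * partial_deriv b w (x0 + t *\<^sub>R b))
        has_real_derivative a * partial_deriv b (partial_deriv b v) (x0 + 0 *\<^sub>R b)
           - M * partial_deriv b (partial_deriv b w) (x0 + 0 *\<^sub>R b)) (at 0)"
      using v(1) w(1) b inS[of 0] e unfolding C2_on_def
      by (intro DERIV_diff DERIV_cmult C1_on_DERIV[of S]) auto
    from second_derivative_nonpos_at_local_max[OF e(1) D1 this]
    show ?thesis using below inS K vx0 by (simp add: subset_eq)
  qed
  have "a * laplacian v x0 - M * laplacian w x0 \<le> 0"
    unfolding laplacian_def sum_distrib_left sum_subtractf[symmetric]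
    using dir by (intro sum_nonpos) auto
  moreover have "- (a * laplacian v x0) \<le> \<nu> * (M * w x0)"
    using v_sub[OF x0S] vx0 M w(3)[OF x0(1)] by simp
  moreover have "M * (\<mu> * w x0) \<le> M * (- laplacian w x0)"
    using w_super[OF x0S] M by (intro mult_left_mono) auto
  ultimately have "\<mu> * (M * w x0) \<le> \<nu> * (M * w x0)"
    by (simp add: algebra_simps)
  then show ?thesis
    using M w(3)[OF x0(1)] by (simp add: mult_le_cancel_right)
qed

section \<open>The Laplacian of radial functions\<close>

lemma inner_add_scaleR_self:
  fixes x b :: "'a::euclidean_space"
  assumes "b \<in> Basis"
  shows "inner (x + t *\<^sub>R b) (x + t *\<^sub>R b) = inner x x + 2 * t * inner x b + t\<^sup>2"
  using assms by (simp add: inner_add_left inner_add_right inner_commute power2_eq_square algebra_simps)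

text \<open>
  For a radial function \<open>G (|x|\<^sup>2)\<close> the Laplacian is the ordinary differential operator
  \<open>2 d G' + 4 s G''\<close> in \<open>s = |x|\<^sup>2\<close>. The variable \<open>|x|\<^sup>2\<close> rather than \<open>|x|\<close> keeps everything smooth at the origin.
\<close>

context
  fixes G G' G'' :: "real \<Rightarrow> real"
  assumes G: "\<And>s. (G has_real_derivative G' s) (at s)"
    and G': "\<And>s. (G' has_real_derivative G'' s) (at s)"
    and G'': "continuous_on UNIV G''"
begin

lemma radial_DERIV:
  fixes x b :: "'a::euclidean_space"
  assumes b: "b \<in> Basis"
  shows "((\<lambda>t. G (inner (x + t *\<^sub>R b) (x + t *\<^sub>R b))) has_real_derivative
    2 * inner x b * G' (inner x x)) (at 0)"
proof -
  have "((\<lambda>t. inner x x + 2 * t * inner x b + t\<^sup>2) has_real_derivative 2 * inner x b) (at 0)"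
    by (auto intro!: derivative_eq_intros)
  then have "((\<lambda>t. G (inner x x + 2 * t * inner x b + t\<^sup>2)) has_real_derivative
    G' (inner x x) * (2 * inner x b)) (at 0)"
    by (intro DERIV_chain2[where f=G]) (simp_all add: G)
  then show ?thesis by (simp add: inner_add_scaleR_self[OF b] mult_ac)
qed

lemma radial_DERIV2:
  fixes x b c :: "'a::euclidean_space"
  assumes c: "c \<in> Basis"
  shows "((\<lambda>t. 2 * inner (x + t *\<^sub>R c) b * G' (inner (x + t *\<^sub>R c) (x + t *\<^sub>R c))) has_real_derivative
    2 * inner c b * G' (inner x x) + 4 * inner x b * inner x c * G'' (inner x x)) (at 0)"
proof -
  have "((\<lambda>t. inner x x + 2 * t * inner x c + t\<^sup>2) has_real_derivative 2 * inner x c) (at 0)"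
    by (auto intro!: derivative_eq_intros)
  then have 1: "((\<lambda>t. G' (inner x x + 2 * t * inner x c + t\<^sup>2)) has_real_derivative
    G'' (inner x x) * (2 * inner x c)) (at 0)"
    by (intro DERIV_chain2[where f=G']) (simp_all add: G')
  have 2: "((\<lambda>t. 2 * (inner x b + t * inner c b)) has_real_derivative 2 * inner c b) (at 0)"
    by (auto intro!: derivative_eq_intros)
  show ?thesis
    using DERIV_mult[OF 2 1] unfolding inner_add_scaleR_self[OF c]
    by (simp add: inner_add_left algebra_simps)
qed

lemma partial_deriv_radial:
  "b \<in> Basis \<Longrightarrow> partial_deriv b (\<lambda>x::'a::euclidean_space. G (inner x x)) = (\<lambda>x. 2 * inner x b * G' (inner x x))"
  unfolding partial_deriv_def by (rule ext) (intro DERIV_imp_deriv radial_DERIV)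

lemma partial_deriv2_radial:
  fixes b c :: "'a::euclidean_space"
  shows "c \<in> Basis \<Longrightarrow> partial_deriv c (\<lambda>x. 2 * inner x b * G' (inner x x))
    = (\<lambda>x. 2 * inner c b * G' (inner x x) + 4 * inner x b * inner x c * G'' (inner x x))"
  unfolding partial_deriv_def by (rule ext) (intro DERIV_imp_deriv radial_DERIV2)

lemma laplacian_radial:
  "laplacian (\<lambda>x::'a::euclidean_space. G (inner x x)) x
    = 2 * real DIM('a) * G' (inner x x) + 4 * inner x x * G'' (inner x x)"
proof -
  have "laplacian (\<lambda>x::'a::euclidean_space. G (inner x x)) x
     = (\<Sum>b\<in>(Basis::'a set). 2 * G' (inner x x) + 4 * (inner x b)\<^sup>2 * G'' (inner x x))"
    unfolding laplacian_def 
    by (intro sum.cong) (simp_all add: partial_deriv_radial partial_deriv2_radial power2_eq_square)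
  also have "\<dots> = 2 * real DIM('a) * G' (inner x x) + 4 * (\<Sum>b\<in>(Basis::'a set). (inner x b)\<^sup>2) * G'' (inner x x)"
    by (simp add: sum.distrib sum_distrib_left sum_distrib_right)
  also have "(\<Sum>b\<in>(Basis::'a set). (inner x b)\<^sup>2) = inner x x"
    by (subst euclidean_inner) (simp add: power2_eq_square)
  finally show ?thesis .
qed

lemma continuous_on_radial:
  "continuous_on S (\<lambda>x::'a::euclidean_space. G (inner x x))"
  "continuous_on S (\<lambda>x::'a::euclidean_space. G' (inner x x))"
  "continuous_on S (\<lambda>x::'a::euclidean_space. G'' (inner x x))"
proof -
  have "continuous_on UNIV G" "continuous_on UNIV G'"
    using G G' by (auto intro!: DERIV_continuous_on)
  with G'' show "continuous_on S (\<lambda>x::'a. G (inner x x))" "continuous_on S (\<lambda>x::'a. G' (inner x x))"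
    "continuous_on S (\<lambda>x::'a. G'' (inner x x))"
    by (auto intro!: continuous_on_compose2[of UNIV _ _ "\<lambda>x. inner x x"] continuous_intros)
qed

lemma C2_on_radial: "C2_on S (\<lambda>x::'a::euclidean_space. G (inner x x))"
proof -
  have "(\<lambda>t. G (inner (x + t *\<^sub>R b) (x + t *\<^sub>R b))) differentiable (at 0)"
    "(\<lambda>t. 2 * inner (x + t *\<^sub>R b) c * G' (inner (x + t *\<^sub>R b) (x + t *\<^sub>R b))) differentiable (at 0)"
    if "b \<in> Basis" for x b c :: 'a
    using radial_DERIV[OF that, of x] radial_DERIV2[OF that, of x c] real_differentiable_def by blast+
  then show ?thesis
    unfolding C2_on_def C1_on_def
    by (simp add: partial_deriv_radial partial_deriv2_radial continuous_on_radial continuous_intros)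
qed

end

section \<open>The ground state of a ball\<close>

text \<open>
  The power series solution \<open>G\<close> of \<open>4 s G'' + 2 d G' + G = 0\<close> with \<open>G 0 = 1\<close>. Up to a normalising factor,
  \<open>G (r\<^sup>2)\<close> is \<open>r powr (1 - d/2)\<close> times the Bessel function of order \<open>d/2 - 1\<close> at \<open>r\<close>.
\<close>

fun radial_coeff :: "nat \<Rightarrow> nat \<Rightarrow> real" where
  "radial_coeff d 0 = 1"
| "radial_coeff d (Suc k) = - radial_coeff d k / ((real k + 1) * (2 * real d + 4 * real k))"

definition radial_series :: "nat \<Rightarrow> real \<Rightarrow> real" where
  "radial_series d s = (\<Sum>k. radial_coeff d k * s ^ k)"

definition radial_series' :: "nat \<Rightarrow> real \<Rightarrow> real" where
  "radial_series' d s = (\<Sum>k. diffs (radial_coeff d) k * s ^ k)"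

definition radial_series'' :: "nat \<Rightarrow> real \<Rightarrow> real" where
  "radial_series'' d s = (\<Sum>k. diffs (diffs (radial_coeff d)) k * s ^ k)"

context
  fixes d :: nat
  assumes d: "d > 0"
begin

lemma summable_radial_series: "summable (\<lambda>k. radial_coeff d k * s ^ k)"
proof (rule summable_ratio_test[where c="1/2" and N="nat \<lceil>\<bar>s\<bar>\<rceil>"])
  fix n assume n: "n \<ge> nat \<lceil>\<bar>s\<bar>\<rceil>"
  define D where "D = (real n + 1) * (2 * real d + 4 * real n)"
  have "2 * \<bar>s\<bar> \<le> 2 * (real n + 1)" using n by (auto simp: nat_le_iff ceiling_le_iff)
  also have "\<dots> \<le> D"
  proof -
    have "(real n + 1) * 2 \<le> (real n + 1) * (2 * real d + 4 * real n)"
      using d by (intro mult_left_mono) auto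
    then show ?thesis by (simp add: D_def)
  qed
  finally have *: "2 * \<bar>s\<bar> \<le> D" .
  have D: "D > 0" using d by (auto simp: D_def intro!: mult_pos_pos)
  have "norm (radial_coeff d (Suc n) * s ^ Suc n) = \<bar>s\<bar> / D * norm (radial_coeff d n * s ^ n)"
  proof -
    have "radial_coeff d (Suc n) = - radial_coeff d n / D" by (simp add: D_def)
    then show ?thesis using D by (simp add: abs_mult del: radial_coeff.simps)
  qed
  also have "\<dots> \<le> 1/2 * norm (radial_coeff d n * s ^ n)"
    using * D by (intro mult_right_mono) (auto simp: field_simps)
  finally show "norm (radial_coeff d (Suc n) * s ^ Suc n) \<le> 1/2 * norm (radial_coeff d n * s ^ n)" .
qed simp

lemmas summable_radial_series' = termdiff_converges_all[OF summable_radial_series]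
lemmas summable_radial_series'' = termdiff_converges_all[OF summable_radial_series']

lemma radial_series_DERIV:
  "(radial_series d has_real_derivative radial_series' d s) (at s)"
  "(radial_series' d has_real_derivative radial_series'' d s) (at s)"
  unfolding radial_series_def radial_series'_def radial_series''_def
  using termdiffs_strong_converges_everywhere[OF summable_radial_series]
    termdiffs_strong_converges_everywhere[OF summable_radial_series'] by simp_all

lemma continuous_radial_series'': "continuous_on UNIV (radial_series'' d)"
proof -
  have "(radial_series'' d has_real_derivative (\<Sum>k. diffs (diffs (diffs (radial_coeff d))) k * s ^ k)) (at s)" for s
    unfolding radial_series''_def
    by (rule termdiffs_strong_converges_everywhere[OF summable_radial_series''])
  then show ?thesis by (auto intro!: DERIV_continuous_on)
qed

lemma radial_series_ode:
  "4 * s * radial_series'' d s + 2 * real d * radial_series' d s + radial_series d s = 0"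
proof -
  define c where "c = radial_coeff d"
  have "(\<lambda>k. diffs (diffs c) k * s ^ k) sums radial_series'' d s"
    unfolding radial_series''_def c_def by (rule summable_sums[OF summable_radial_series''])
  then have "(\<lambda>k. s * (diffs (diffs c) k * s ^ k)) sums (s * radial_series'' d s)"
    by (rule sums_mult)
  then have "(\<lambda>k. real (Suc k) * diffs c (Suc k) * s ^ Suc k) sums (s * radial_series'' d s)"
    by (simp add: diffs_def algebra_simps)
  then have 1: "(\<lambda>k. real k * diffs c k * s ^ k) sums (s * radial_series'' d s)"
    by (subst (asm) sums_Suc_iff) simp
  have 2: "(\<lambda>k. diffs c k * s ^ k) sums radial_series' d s"
    unfolding radial_series'_def c_def by (rule summable_sums[OF summable_radial_series'])
  have 3: "(\<lambda>k. c k * s ^ k) sums radial_series d s"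
    unfolding radial_series_def c_def by (rule summable_sums[OF summable_radial_series])
  have "(\<lambda>k. 4 * (real k * diffs c k * s ^ k) + 2 * real d * (diffs c k * s ^ k) + c k * s ^ k) sums
      (4 * (s * radial_series'' d s) + 2 * real d * radial_series' d s + radial_series d s)"
    by (intro sums_add sums_mult 1 2 3)
  moreover have "4 * (real k * diffs c k * s ^ k) + 2 * real d * (diffs c k * s ^ k) + c k * s ^ k = 0" for k
  proof -
    have "diffs c k * (2 * real d + 4 * real k) = - c k"
    proof -
      have "2 * real d + 4 * real k > 0" "real k + 1 > 0" using d by auto
      then show ?thesis
        by (simp add: c_def diffs_def divide_simps)
    qed
    then have "(diffs c k * (2 * real d + 4 * real k) + c k) * s ^ k = 0" by simp
    then show ?thesis by (simp add: algebra_simps)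
  qed
  ultimately show ?thesis
    using sums_unique2[OF _ sums_zero] by (simp add: mult.assoc)
qed

lemma radial_series_0: "radial_series d 0 = 1"
  unfolding radial_series_def by (simp add: powser_zero)

end

text \<open>
  A radial solution of \<open>- \<Delta> w = \<mu> w\<close> on the whole space, with value \<open>1\<close> at the origin.
\<close>

definition radial_wave :: "real \<Rightarrow> 'a::euclidean_space \<Rightarrow> real" where
  "radial_wave \<mu> x = radial_series DIM('a) (\<mu> * inner x x)"

lemma radial_wave:
  shows C2_on_radial_wave: "C2_on S (radial_wave \<mu> :: 'a::euclidean_space \<Rightarrow> real)"
    and continuous_on_radial_wave: "continuous_on S (radial_wave \<mu> :: 'a::euclidean_space \<Rightarrow> real)"
    and laplacian_radial_wave: "laplacian (radial_wave \<mu>) (x::'a) = - (\<mu> * radial_wave \<mu> x)"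
proof -
  let ?d = "DIM('a)"
  define G where "G s = radial_series ?d (\<mu> * s)" for s
  define G' where "G' s = \<mu> * radial_series' ?d (\<mu> * s)" for s
  define G'' where "G'' s = \<mu>\<^sup>2 * radial_series'' ?d (\<mu> * s)" for s
  have G: "(G has_real_derivative G' s) (at s)" for s
    unfolding G_def G'_def
    by (rule DERIV_chain2[OF radial_series_DERIV(1), THEN DERIV_cong])
      (auto intro!: derivative_eq_intros)
  have G': "(G' has_real_derivative G'' s) (at s)" for s
    unfolding G'_def G''_def
    by (rule DERIV_cmult[OF DERIV_chain2[OF radial_series_DERIV(2)], THEN DERIV_cong])
      (auto intro!: derivative_eq_intros simp: power2_eq_square)
  have G'': "continuous_on UNIV G''"
    unfolding G''_def
    by (intro continuous_intros continuous_on_compose2[OF continuous_radial_series'']) auto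
  have eq: "radial_wave \<mu> = (\<lambda>x::'a. G (inner x x))"
    by (simp add: radial_wave_def G_def fun_eq_iff)
  show "C2_on S (radial_wave \<mu> :: 'a \<Rightarrow> real)"
    unfolding eq by (rule C2_on_radial[OF G G' G''])
  show "continuous_on S (radial_wave \<mu> :: 'a \<Rightarrow> real)"
    unfolding eq by (rule continuous_on_radial(1)[OF G G' G''])
  have "laplacian (radial_wave \<mu>) x = \<mu> * (4 * (\<mu> * inner x x) * radial_series'' ?d (\<mu> * inner x x) +
      2 * real ?d * radial_series' ?d (\<mu> * inner x x))"
    unfolding eq laplacian_radial[OF G G' G'']
    by (simp add: G'_def G''_def power2_eq_square algebra_simps)
  also have "4 * (\<mu> * inner x x) * radial_series'' ?d (\<mu> * inner x x) +
      2 * real ?d * radial_series' ?d (\<mu> * inner x x) = - radial_wave \<mu> x"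
    using radial_series_ode[of ?d "\<mu> * inner x x"] by (simp add: radial_wave_def)
  finally show "laplacian (radial_wave \<mu>) (x::'a) = - (\<mu> * radial_wave \<mu> x)" by simp
qed

text \<open>
  If the series stayed positive, the radial wave for \<open>\<mu> = 1\<close> would be a positive solution on every ball.
  On the ball of radius \<open>R = d + 2\<close> the polynomial \<open>(R\<^sup>2 - |x|\<^sup>2)\<^sup>2\<close> is a subsolution for \<open>1/2\<close> with zero
  boundary values, so the comparison principle would give \<open>1 \<le> 1/2\<close>.
\<close>

lemma radial_series_has_zero:
  "\<exists>s\<ge>0. radial_series DIM('a::euclidean_space) s \<le> 0"
proof (rule ccontr)
  assume "\<not> ?thesis"
  then have pos: "radial_series DIM('a) s > 0" if "s \<ge> 0" for s
    using that by force
  define R where "R = real DIM('a) + 2"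
  define v where "v x = (R\<^sup>2 - inner x x)\<^sup>2" for x :: 'a
  have R: "R > 0" by (simp add: R_def)
  define H where "H s = (R\<^sup>2 - s)\<^sup>2" for s
  define H' where "H' s = - 2 * (R\<^sup>2 - s)" for s
  define H'' where "H'' s = (2::real)" for s :: real
  have H: "(H has_real_derivative H' s) (at s)" "(H' has_real_derivative H'' s) (at s)"
    "continuous_on UNIV H''" for s
    unfolding H_def H'_def H''_def by (auto intro!: derivative_eq_intros)
  have v: "v = (\<lambda>x. H (inner x x))"
    by (simp add: v_def H_def fun_eq_iff)
  have inball: "x \<in> ball 0 R \<longleftrightarrow> inner x x < R\<^sup>2" "x \<in> cball 0 R \<longleftrightarrow> inner x x \<le> R\<^sup>2" for x :: 'a
    using R by (auto simp: norm_lt_square norm_le_square)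
  have "(1::real) \<le> 1/2"
  proof (rule dirichlet_comparison[of "cball (0::'a) R" "ball 0 R" v 1 "1/2" 0 "radial_wave 1"])
    show "C2_on (ball 0 R) v" "continuous_on (cball 0 R) v"
      unfolding v by (rule C2_on_radial[OF H] continuous_on_radial(1)[OF H])+
    show "v x = 0" if "x \<in> cball 0 R - ball 0 R" for x
      using that inball[of x] by (simp add: v_def)
    show "- (1 * laplacian v x) \<le> 1/2 * (1 * v x)" for x
    proof -
      define t where "t = R\<^sup>2 - inner x x"
      \<comment> \<open>\<open>R\<close> was chosen so that this quadratic in \<open>t\<close> is a perfect square\<close>
      have "0 \<le> (t - 4 * R)\<^sup>2" by simp
      then have "4 * R * t - 8 * R\<^sup>2 \<le> 1/2 * t\<^sup>2"
        by (simp add: power2_eq_square algebra_simps)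
      moreover have "laplacian v x = 8 * R\<^sup>2 - 4 * R * t"
        unfolding v laplacian_radial[OF H]
        by (simp add: H'_def H''_def t_def R_def power2_eq_square algebra_simps)
      ultimately show ?thesis by (simp add: v_def t_def)
    qed
    show "radial_wave 1 x > 0" for x :: 'a
      by (simp add: radial_wave_def pos)
  qed (use R in \<open>auto simp: v_def C2_on_radial_wave continuous_on_radial_wave laplacian_radial_wave\<close>)
  then show False by simp
qed

lemma radial_series_first_zero:
  obtains s0 where "s0 > 0" "radial_series DIM('a::euclidean_space) s0 = 0"
    "\<And>s. 0 \<le> s \<Longrightarrow> s < s0 \<Longrightarrow> radial_series DIM('a) s > 0"
proof -
  let ?G = "radial_series DIM('a)"
  have cont: "continuous_on S ?G" for S
    by (rule DERIV_continuous_on[OF has_field_derivative_at_within[OF radial_series_DERIV(1)]]) auto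
  define Z where "Z = {s. 0 \<le> s \<and> ?G s = 0}"
  have ivt: "\<exists>z. 0 \<le> z \<and> z \<le> s \<and> ?G z = 0" if "0 \<le> s" "?G s \<le> 0" for s
    using IVT2'[of ?G s 0 0] that cont radial_series_0[of "DIM('a)"] by auto
  have "Z \<noteq> {}" using radial_series_has_zero[where 'a='a] ivt by (auto simp: Z_def)
  moreover have "closed Z"
  proof -
    have "closed ({0..} \<inter> ?G -` {0})"
      by (intro continuous_closed_preimage cont) auto
    also have "{0..} \<inter> ?G -` {0} = Z" by (auto simp: Z_def)
    finally show ?thesis .
  qed
  moreover have bdd: "bdd_below Z" by (rule bdd_belowI[of _ 0]) (auto simp: Z_def)
  ultimately have InfZ: "Inf Z \<in> Z" using closed_contains_Inf by blast
  show thesis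
  proof (rule that[of "Inf Z"])
    show "Inf Z > 0" using InfZ radial_series_0[of "DIM('a)"]
      by (cases "Inf Z = 0") (auto simp: Z_def)
    show "?G (Inf Z) = 0" using InfZ by (simp add: Z_def)
    show "?G s > 0" if "0 \<le> s" "s < Inf Z" for s
    proof (rule ccontr)
      assume "\<not> ?G s > 0"
      with ivt[of s] that obtain z where "z \<in> Z" "z \<le> s" by (auto simp: Z_def)
      then show False using cInf_lower[OF _ bdd, of z] that by auto
    qed
  qed
qed

text \<open>
  With \<open>s0\<close> the first zero of the series, the radial wave for \<open>\<mu> = 4 s0\<close> vanishes on the sphere
  \<open>|x|\<^sup>2 = 1/4\<close>, so \<open>4 s0\<close> is an eigenvalue. It is the least one: for \<open>0 < \<mu> < 4 s0\<close> the radial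
  wave is positive on the closed ball, and comparison with it bounds every eigenvalue below by \<open>\<mu>\<close>.
  Exhibiting the least eigenvalue is needed for the definite description behind \<open>dirichlet_lambda_min\<close> to
  have its intended value.
\<close>

lemma dirichlet_lambda_min_ball_pos:
  "dirichlet_lambda_min (ball (0::'a::euclidean_space) (1/2)) > 0"
proof -
  let ?B = "ball (0::'a) (1/2)" and ?C = "cball (0::'a) (1/2)"
  obtain s0 where s0: "s0 > 0" "radial_series DIM('a) s0 = 0"
    "\<And>s. 0 \<le> s \<Longrightarrow> s < s0 \<Longrightarrow> radial_series DIM('a) s > 0"
    using radial_series_first_zero[where 'a='a] by blast
  have closure: "closure ?B = ?C" and frontier: "frontier ?B = sphere 0 (1/2)"
    by simp_all
  have sphere: "inner x x = 1/4" if "x \<in> sphere 0 (1/2)" for x :: 'a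
  proof -
    have "norm x = 1/2" using that by simp
    then show ?thesis by (simp only: dot_square_norm power_divide) simp
  qed
  have cball: "inner x x \<le> 1/4" if "x \<in> ?C" for x :: 'a
    using power_mono[of "norm x" "1/2" 2] that by (simp add: dot_square_norm power_divide)
  have eig: "dirichlet_eigenvalue ?B (4 * s0)"
    unfolding dirichlet_eigenvalue_def closure frontier
  proof (intro exI conjI ballI)
    show "C2_on ?B (radial_wave (4 * s0))" "continuous_on ?C (radial_wave (4 * s0))"
      by (rule C2_on_radial_wave continuous_on_radial_wave)+
    show "radial_wave (4 * s0) x = 0" if "x \<in> sphere 0 (1/2)" for x :: 'a
    proof -
      have "4 * s0 * inner x x = s0" using sphere[OF that] by simp
      then show ?thesis using s0(2) by (simp only: radial_wave_def)
    qed
    show "\<exists>x\<in>?B. radial_wave (4 * s0) x \<noteq> 0"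
      by (rule bexI[of _ 0]) (simp_all add: radial_wave_def radial_series_0)
  qed (simp add: laplacian_radial_wave)
  have min: "4 * s0 \<le> \<nu>" if \<nu>: "dirichlet_eigenvalue ?B \<nu>" for \<nu>
  proof (rule ccontr)
    assume "\<not> 4 * s0 \<le> \<nu>"
    \<comment> \<open>\<open>\<mu>\<close> strictly below \<open>4 * s0\<close> keeps the comparison function positive on the boundary as well\<close>
    then obtain \<mu> where \<mu>: "max 0 \<nu> < \<mu>" "\<mu> < 4 * s0"
      using dense[of "max 0 \<nu>" "4 * s0"] s0(1) by auto
    obtain u x1 where u: "C2_on ?B u" "continuous_on ?C u" "\<And>x. x \<in> sphere 0 (1/2) \<Longrightarrow> u x = 0"
      "x1 \<in> ?B" "u x1 \<noteq> 0" "\<And>x. x \<in> ?B \<Longrightarrow> - laplacian u x = \<nu> * u x"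
      using \<nu> unfolding dirichlet_eigenvalue_def closure frontier by blast
    have wpos: "radial_wave \<mu> x > 0" if "x \<in> ?C" for x :: 'a
    proof -
      have "\<mu> * inner x x \<le> \<mu> * (1/4)"
        using cball[OF that] \<mu> by (intro mult_left_mono) auto
      also have "\<dots> < s0" using \<mu> by simp
      finally have "\<mu> * inner x x < s0" .
      then show ?thesis
        unfolding radial_wave_def using \<mu> by (intro s0(3)) auto
    qed
    have "\<mu> \<le> \<nu>"
    proof (rule dirichlet_comparison[of ?C ?B u "sgn (u x1)" \<nu> x1 "radial_wave \<mu>"])
      show "- (sgn (u x1) * laplacian u x) \<le> \<nu> * (sgn (u x1) * u x)" if "x \<in> ?B" for x
      proof -
        have "laplacian u x = - (\<nu> * u x)" using u(6)[OF that] by simp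
        then show ?thesis by simp
      qed
      show "0 < sgn (u x1) * u x1" using u(5) by (simp add: sgn_if)
    qed (use u wpos in \<open>auto simp: C2_on_radial_wave continuous_on_radial_wave laplacian_radial_wave\<close>)
    then show False using \<mu> by simp
  qed
  have "dirichlet_lambda_min ?B = 4 * s0"
    unfolding dirichlet_lambda_min_def using eig min by (rule Least_equality)
  then show ?thesis using s0 by simp
qed

corollary c0_pos: "c0 TYPE('d::finite) > 0"
  unfolding c0_def using dirichlet_lambda_min_ball_pos[where 'a="real^'d"] by simp

section \<open>Fourier transforms of Gaussians\<close>

text \<open>
  A rescaling of the characteristic function of the standard normal distribution.
\<close>

lemma gaussian_fourier_real:
  fixes t y :: real
  assumes t: "t > 0"
  shows "has_bochner_integral lborel (\<lambda>\<omega>. complex_of_real (exp (- t * \<omega>\<^sup>2)) * iexp (\<omega> * y))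
    (complex_of_real (sqrt (pi / t) * exp (- y\<^sup>2 / (4 * t))))"
proof -
  define c where "c = sqrt (2 * t)"
  have c: "c > 0" "c\<^sup>2 = 2 * t" using t by (simp_all add: c_def)
  define f where "f x = complex_of_real (std_normal_density x) * iexp (y / c * x)" for x
  have int_f: "integrable lborel f"
  proof (rule Bochner_Integration.integrable_bound)
    show "integrable lborel std_normal_density" by (rule integrable_normal_density) simp
    show "f \<in> borel_measurable lborel" unfolding f_def by measurable
  qed (simp add: f_def norm_mult)
  have "integral\<^sup>L lborel f = complex_of_real (exp (- (y / c)\<^sup>2 / 2))"
    using fun_cong[OF char_std_normal_distribution, of "y / c"]
    by (simp add: char_def integral_density f_def[abs_def] scaleR_conv_of_real)
  then have f: "has_bochner_integral lborel f (complex_of_real (exp (- y\<^sup>2 / (4 * t))))"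
    using int_f c by (simp add: has_bochner_integral_iff power_divide)
  have fc: "f (c * \<omega>) = complex_of_real (1 / sqrt (2 * pi)) * (complex_of_real (exp (- t * \<omega>\<^sup>2)) * iexp (\<omega> * y))" for \<omega>
  proof -
    have "- (c * \<omega>)\<^sup>2 / 2 = - t * \<omega>\<^sup>2" using c by (simp add: power_mult_distrib)
    then show ?thesis using c by (simp add: f_def std_normal_density_def mult_ac)
  qed
  have int: "integrable lborel (\<lambda>\<omega>. f (c * \<omega>))"
    using lborel_integrable_real_affine[OF int_f, of c 0] c by simp
  have "integral\<^sup>L lborel f = c *\<^sub>R integral\<^sup>L lborel (\<lambda>\<omega>. f (c * \<omega>))"
    using lborel_integral_real_affine[of c f 0] c by simp
  then have "integral\<^sup>L lborel (\<lambda>\<omega>. f (c * \<omega>)) = complex_of_real (exp (- y\<^sup>2 / (4 * t)) / c)"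
    using f c by (simp add: has_bochner_integral_iff scaleR_conv_of_real field_simps)
  with int have "has_bochner_integral lborel (\<lambda>\<omega>. complex_of_real (sqrt (2 * pi)) * f (c * \<omega>))
     (complex_of_real (sqrt (2 * pi)) * complex_of_real (exp (- y\<^sup>2 / (4 * t)) / c))"
    by (intro has_bochner_integral_mult_right) (simp add: has_bochner_integral_iff)
  moreover have "complex_of_real (sqrt (2 * pi)) * complex_of_real (exp (- y\<^sup>2 / (4 * t)) / c)
      = complex_of_real (sqrt (pi / t) * exp (- y\<^sup>2 / (4 * t)))"
  proof -
    have "sqrt (2 * pi) * (exp (- y\<^sup>2 / (4 * t)) / c) = sqrt (2 * pi) / sqrt (2 * t) * exp (- y\<^sup>2 / (4 * t))"
      by (simp add: c_def)
    also have "sqrt (2 * pi) / sqrt (2 * t) = sqrt (pi / t)"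
      by (simp add: real_sqrt_divide[symmetric])
    finally show ?thesis by (simp only: of_real_mult[symmetric])
  qed
  moreover have "complex_of_real (sqrt (2 * pi)) * f (c * \<omega>) = complex_of_real (exp (- t * \<omega>\<^sup>2)) * iexp (\<omega> * y)" for \<omega>
    unfolding fc mult.assoc[symmetric] of_real_mult[symmetric] by simp
  ultimately show ?thesis by (simp only:)
qed

lemma lborel_integral_prod:
  fixes f :: "'a::euclidean_space \<Rightarrow> real \<Rightarrow> 'b::{real_normed_field, banach, second_countable_topology}"
  assumes f: "\<And>b. b \<in> Basis \<Longrightarrow> has_bochner_integral lborel (f b) (I b)"
  shows "has_bochner_integral lborel (\<lambda>x. \<Prod>b\<in>Basis. f b (inner x b)) (\<Prod>b\<in>Basis. I b)"
proof -
  interpret product_sigma_finite "\<lambda>_::'a. lborel :: real measure" ..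
  have meas: "f b \<in> borel_measurable borel" if "b \<in> Basis" for b
    using f[OF that] by (auto dest: has_bochner_integral_integrable borel_measurable_integrable simp: has_bochner_integral_iff)
  have eq: "(\<Prod>b\<in>Basis. f b (inner (\<Sum>c\<in>Basis. x c *\<^sub>R c) b)) = (\<Prod>b\<in>Basis. f b (x b))" for x :: "'a \<Rightarrow> real"
    by (intro prod.cong refl) (simp add: inner_sum_left inner_Basis if_distrib sum.delta' cong: if_cong)
  have "has_bochner_integral (\<Pi>\<^sub>M b\<in>(Basis::'a set). lborel) (\<lambda>x. \<Prod>b\<in>Basis. f b (x b)) (\<Prod>b\<in>Basis. I b)"
    using f by (auto simp: has_bochner_integral_iff product_integral_prod intro!: product_integrable_prod)
  then show ?thesis
    using meas
    by (subst lborel_eq, intro has_bochner_integral_distr) (auto simp: eq intro!: borel_measurable_prod)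
qed

lemma gaussian_fourier:
  fixes y :: "'a::euclidean_space"
  assumes t: "t > 0"
  shows "has_bochner_integral lborel (\<lambda>\<omega>. exp (- t * (norm \<omega>)\<^sup>2) * cos (inner \<omega> y))
    ((pi / t) powr (DIM('a) / 2) * exp (- (norm y)\<^sup>2 / (4 * t)))"
proof -
  have norm2: "(norm x)\<^sup>2 = (\<Sum>b\<in>Basis. (inner x b)\<^sup>2)" for x :: 'a
    unfolding power2_norm_eq_inner by (subst euclidean_inner) (simp add: power2_eq_square)
  have "has_bochner_integral lborel
      (\<lambda>\<omega>::'a. \<Prod>b\<in>Basis. complex_of_real (exp (- t * (inner \<omega> b)\<^sup>2)) * iexp (inner \<omega> b * inner y b))
      (\<Prod>b\<in>(Basis::'a set). complex_of_real (sqrt (pi / t) * exp (- (inner y b)\<^sup>2 / (4 * t))))"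
    by (rule lborel_integral_prod[OF gaussian_fourier_real[OF t]])
  moreover have "(\<Prod>b\<in>Basis. complex_of_real (exp (- t * (inner \<omega> b)\<^sup>2)) * iexp (inner \<omega> b * inner y b))
     = complex_of_real (exp (- t * (norm \<omega>)\<^sup>2)) * iexp (inner \<omega> y)" for \<omega> :: 'a
    unfolding prod.distrib norm2
    by (subst (3) euclidean_inner) (simp add: exp_sum[symmetric] sum_distrib_left of_real_prod[symmetric] sum_negf
        del: of_real_prod of_real_mult)
  moreover have "(\<Prod>b\<in>(Basis::'a set). sqrt (pi / t) * exp (- (inner y b)\<^sup>2 / (4 * t)))
     = (pi / t) powr (DIM('a) / 2) * exp (- (norm y)\<^sup>2 / (4 * t))"
    unfolding prod.distrib norm2
    using t by (simp add: exp_sum[symmetric] powr_half_sqrt[symmetric] powr_powr powr_realpow[symmetric]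
        sum_negf sum_divide_distrib)
  ultimately have "has_bochner_integral lborel
      (\<lambda>\<omega>::'a. complex_of_real (exp (- t * (norm \<omega>)\<^sup>2)) * iexp (inner \<omega> y))
      (complex_of_real ((pi / t) powr (DIM('a) / 2) * exp (- (norm y)\<^sup>2 / (4 * t))))"
    by (simp only: of_real_prod[symmetric])
  from has_bochner_integral_Re[OF this] show ?thesis
    by (simp add: Re_exp)
qed

section \<open>Gaussian sums over separated points\<close>

text \<open>
  Balls of radius \<open>q/2\<close> around the translates \<open>x - z\<close> are disjoint, and on each of them \<open>|y| \<le> 3/2 |x - z|\<close>,
  because \<open>|x - z| \<ge> q\<close>. So every summand is at most \<open>exp (- |y|\<^sup>2 / (9 t))\<close> throughout its own ball, and
  the sum times the volume of one ball is at most the integral of this wider Gaussian.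
\<close>

lemma gaussian_sum_packing:
  fixes z :: "'a::euclidean_space"
  assumes X: "finite X" and q: "q > 0" and t: "t > 0"
    and sep: "\<And>x y. x \<in> insert z X \<Longrightarrow> y \<in> insert z X \<Longrightarrow> x \<noteq> y \<Longrightarrow> q \<le> norm (x - y)"
    and z: "z \<notin> X"
  shows "(\<Sum>x\<in>X. exp (- (norm (x - z))\<^sup>2 / (4 * t))) * measure lborel (ball (0::'a) (q / 2)) \<le> (9 * pi * t) powr (DIM('a) / 2)"
proof -
  define c where "c x = exp (- (norm (x - z))\<^sup>2 / (4 * t))" for x
  have g: "has_bochner_integral lborel (\<lambda>y::'a. exp (- (norm y)\<^sup>2 / (9 * t))) ((9 * pi * t) powr (DIM('a) / 2))"
    using gaussian_fourier[of "1 / (9 * t)" "0::'a"] t by (simp add: mult_ac)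
  have b: "has_bochner_integral lborel (\<lambda>y. \<Sum>x\<in>X. c x * indicator (ball (x - z) (q / 2)) y)
    (\<Sum>x\<in>X. c x * measure lborel (ball (x - z) (q / 2)))"
    by (intro has_bochner_integral_sum has_bochner_integral_mult_right has_bochner_integral_real_indicator
        emeasure_lborel_ball_finite) auto
  have "(\<Sum>x\<in>X. c x * indicator (ball (x - z) (q / 2)) y) \<le> exp (- (norm y)\<^sup>2 / (9 * t))" for y
  proof (cases "\<exists>x\<in>X. y \<in> ball (x - z) (q / 2)")
    case False
    then have "(\<Sum>x\<in>X. c x * indicator (ball (x - z) (q / 2)) y) = 0"
      by (intro sum.neutral) auto
    then show ?thesis by simp
  next
    case True
    then obtain x where x: "x \<in> X" "y \<in> ball (x - z) (q / 2)" by blast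
    have "indicator (ball (x' - z) (q / 2)) y = (0::real)" if "x' \<in> X - {x}" for x'
    proof -
      have "q \<le> norm (x' - x)" using sep[of x' x] that x by auto
      also have "x' - x = (x' - z - y) - (x - z - y)" by simp
      also have "norm \<dots> \<le> norm (x' - z - y) + norm (x - z - y)" by (rule norm_triangle_ineq4)
      finally show ?thesis using x by (auto simp: dist_norm indicator_def)
    qed
    then have "(\<Sum>x'\<in>X. c x' * indicator (ball (x' - z) (q / 2)) y) = c x"
      using x by (simp add: sum.remove[OF X x(1)])
    also have "c x \<le> exp (- (norm y)\<^sup>2 / (9 * t))"
    proof -
      have "x \<noteq> z" using x z by auto
      then have "q \<le> norm (x - z)" using sep[of x z] x by auto
      moreover have "norm y \<le> norm (x - z) + norm (y - (x - z))"
        by (metis add.commute diff_add_cancel norm_triangle_ineq)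
      moreover have "norm (y - (x - z)) < q / 2" using x by (simp add: dist_norm norm_minus_commute)
      ultimately have "2 * norm y \<le> 3 * norm (x - z)" by simp
      then have "(2 * norm y)\<^sup>2 \<le> (3 * norm (x - z))\<^sup>2" by (intro power_mono) auto
      then show ?thesis using t by (simp add: c_def power_mult_distrib field_simps)
    qed
    finally show ?thesis .
  qed
  then have "(\<Sum>x\<in>X. c x * measure lborel (ball (x - z) (q / 2))) \<le> (9 * pi * t) powr (DIM('a) / 2)"
    using integral_mono[of lborel "\<lambda>y. \<Sum>x\<in>X. c x * indicator (ball (x - z) (q / 2)) y"
        "\<lambda>y. exp (- (norm y)\<^sup>2 / (9 * t))"] g b
    by (simp add: has_bochner_integral_iff)
  then show ?thesis
    using q by (simp add: content_ball sum_distrib_right c_def)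
qed

text \<open>
  The quadratic form of Gershgorin's circle theorem: bounding \<open>\<alpha> i * \<alpha> j\<close> by the mean of the two squares turns
  the off-diagonal part into row sums.
\<close>

lemma quadratic_form_diagonally_dominant:
  fixes K :: "nat \<Rightarrow> nat \<Rightarrow> real"
  assumes diag: "\<And>i. i < n \<Longrightarrow> K i i = 1"
    and sym: "\<And>i j. K i j = K j i" and nonneg: "\<And>i j. K i j \<ge> 0"
    and off: "\<And>i. i < n \<Longrightarrow> (\<Sum>j\<in>{..<n} - {i}. K i j) \<le> 1/2"
  shows "\<bar>(\<Sum>i<n. \<Sum>j<n. \<alpha> i * \<alpha> j * K i j) - (\<Sum>i<n. (\<alpha> i)\<^sup>2)\<bar> \<le> 1/2 * (\<Sum>i<n. (\<alpha> i)\<^sup>2)"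
proof -
  define off where "off i j = (if i = j then 0 else K i j)" for i j
  have row: "(\<Sum>j<n. off i j) \<le> 1/2" if "i < n" for i
    using assms(4)[OF that] that by (simp add: off_def sum.remove[of _ i])
  have off_nn: "off i j \<ge> 0" and off_sym: "off i j = off j i" for i j
    using sym[of i j] nonneg[of i j] by (auto simp: off_def)
  have "(\<Sum>i<n. \<Sum>j<n. \<alpha> i * \<alpha> j * K i j) - (\<Sum>i<n. (\<alpha> i)\<^sup>2)
     = (\<Sum>i<n. (\<Sum>j<n. \<alpha> i * \<alpha> j * K i j) - (\<alpha> i)\<^sup>2)"
    by (simp add: sum_subtractf)
  also have "\<dots> = (\<Sum>i<n. \<Sum>j<n. \<alpha> i * \<alpha> j * off i j)"
  proof (intro sum.cong refl)
    fix i assume "i \<in> {..<n}"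
    then show "(\<Sum>j<n. \<alpha> i * \<alpha> j * K i j) - (\<alpha> i)\<^sup>2 = (\<Sum>j<n. \<alpha> i * \<alpha> j * off i j)"
      by (simp add: sum.remove[of _ i] diag off_def power2_eq_square)
  qed
  finally have eq: "(\<Sum>i<n. \<Sum>j<n. \<alpha> i * \<alpha> j * K i j) - (\<Sum>i<n. (\<alpha> i)\<^sup>2) = (\<Sum>i<n. \<Sum>j<n. \<alpha> i * \<alpha> j * off i j)" .
  have "\<bar>\<Sum>i<n. \<Sum>j<n. \<alpha> i * \<alpha> j * off i j\<bar> \<le> (\<Sum>i<n. \<Sum>j<n. \<bar>\<alpha> i * \<alpha> j * off i j\<bar>)"
    by (intro order_trans[OF sum_abs] sum_mono sum_abs)
  also have "\<dots> \<le> (\<Sum>i<n. \<Sum>j<n. ((\<alpha> i)\<^sup>2 / 2 + (\<alpha> j)\<^sup>2 / 2) * off i j)"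
  proof (intro sum_mono)
    fix i j
    have "0 \<le> (\<bar>\<alpha> i\<bar> - \<bar>\<alpha> j\<bar>)\<^sup>2" by simp
    then have "\<bar>\<alpha> i * \<alpha> j\<bar> \<le> (\<alpha> i)\<^sup>2 / 2 + (\<alpha> j)\<^sup>2 / 2"
      by (simp add: power2_diff abs_mult)
    then show "\<bar>\<alpha> i * \<alpha> j * off i j\<bar> \<le> ((\<alpha> i)\<^sup>2 / 2 + (\<alpha> j)\<^sup>2 / 2) * off i j"
      using off_nn[of i j] by (simp add: abs_mult mult_right_mono)
  qed
  also have "\<dots> = (\<Sum>i<n. \<Sum>j<n. (\<alpha> i)\<^sup>2 / 2 * off i j) + (\<Sum>i<n. \<Sum>j<n. (\<alpha> j)\<^sup>2 / 2 * off i j)"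
    by (simp add: sum.distrib algebra_simps)
  also have "(\<Sum>i<n. \<Sum>j<n. (\<alpha> j)\<^sup>2 / 2 * off i j) = (\<Sum>i<n. \<Sum>j<n. (\<alpha> i)\<^sup>2 / 2 * off i j)"
    by (subst sum.swap) (simp add: off_sym)
  also have "(\<Sum>i<n. \<Sum>j<n. (\<alpha> i)\<^sup>2 / 2 * off i j) + (\<Sum>i<n. \<Sum>j<n. (\<alpha> i)\<^sup>2 / 2 * off i j)
    = (\<Sum>i<n. (\<alpha> i)\<^sup>2 * (\<Sum>j<n. off i j))"
    by (simp add: sum_distrib_left sum_distrib_right sum.distrib[symmetric] mult.commute)
  also have "\<dots> \<le> (\<Sum>i<n. (\<alpha> i)\<^sup>2 * (1/2))"
    using row by (intro sum_mono mult_left_mono) auto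
  finally show ?thesis unfolding eq by (simp add: sum_distrib_left mult_ac)
qed

lemma power2_powr:
  fixes q :: real
  assumes "q > 0"
  shows "(q\<^sup>2) powr s = q powr (2 * s)"
proof -
  have "q\<^sup>2 = q powr 2" using assms by simp
  then show ?thesis by (simp only: powr_powr)
qed

text \<open>
  The packing bound is \<open>(36 \<pi> t / q\<^sup>2) powr (d/2)\<close> up to the volume of the unit ball, so it is small when
  \<open>t / q\<^sup>2\<close> is small.
\<close>

lemma gaussian_sum_le_half:
  "\<exists>\<kappa>>0. \<kappa> \<le> 1 \<and> (\<forall>X z q t. finite X \<and> z \<notin> X \<and> q > 0 \<and> 0 < t \<and> t \<le> \<kappa> * q\<^sup>2 \<and>
     (\<forall>x\<in>insert z X. \<forall>y\<in>insert z X. x \<noteq> y \<longrightarrow> q \<le> norm (x - y)) \<longrightarrow>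
     (\<Sum>x\<in>X. exp (- (norm (x - z :: 'a::euclidean_space))\<^sup>2 / (4 * t))) \<le> 1/2)"
proof -
  let ?D = "real DIM('a) / 2"
  define V where "V = measure lborel (ball (0::'a) (1/2))"
  have V: "V > 0" unfolding V_def by simp
  have D: "?D > 0" by simp
  \<comment> \<open>the value for which the packing bound at \<open>t = \<kappa> q\<^sup>2\<close> equals \<open>1/2\<close>, cut off at \<open>1\<close>\<close>
  define \<kappa> where "\<kappa> = min 1 ((V / 2) powr (1 / ?D) / (9 * pi))"
  have \<kappa>: "0 < \<kappa>" "\<kappa> \<le> 1" using V by (auto simp: \<kappa>_def)
  have "(9 * pi * \<kappa>) powr ?D \<le> ((V / 2) powr (1 / ?D)) powr ?D"
  proof (rule powr_mono2)
    have "\<kappa> \<le> (V / 2) powr (1 / ?D) / (9 * pi)" by (simp add: \<kappa>_def)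
    then show "9 * pi * \<kappa> \<le> (V / 2) powr (1 / ?D)" by (simp add: field_simps)
  qed (use \<kappa> in auto)
  then have small: "(9 * pi * \<kappa>) powr ?D \<le> V / 2"
    using V by (simp add: powr_powr)
  show ?thesis
  proof (intro exI[of _ \<kappa>] conjI \<kappa> allI impI, elim conjE)
    fix X :: "'a set" and z q t
    assume *: "finite X" "z \<notin> X" "q > 0" "0 < t" "t \<le> \<kappa> * q\<^sup>2"
      "\<forall>x\<in>insert z X. \<forall>y\<in>insert z X. x \<noteq> y \<longrightarrow> q \<le> norm (x - y)"
    let ?S = "\<Sum>x\<in>X. exp (- (norm (x - z))\<^sup>2 / (4 * t))"
    have "measure lborel (ball (0::'a) (q / 2)) = V * q ^ DIM('a)"
      using * by (simp add: V_def content_ball power_divide)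
    then have "?S * (V * q ^ DIM('a)) \<le> (9 * pi * t) powr ?D"
      using gaussian_sum_packing[of X q t z] * by auto
    also have "\<dots> \<le> (9 * pi * \<kappa> * q\<^sup>2) powr ?D"
      using * by (intro powr_mono2) auto
    also have "\<dots> = (9 * pi * \<kappa>) powr ?D * q ^ DIM('a)"
    proof -
      have "(q\<^sup>2) powr ?D = q ^ DIM('a)"
        using * by (simp add: power2_powr powr_realpow)
      then show ?thesis using \<kappa> by (simp add: powr_mult)
    qed
    also have "\<dots> \<le> V / 2 * q ^ DIM('a)"
      using small * by (intro mult_right_mono) auto
    finally have "?S * (V * q ^ DIM('a)) \<le> 1/2 * (V * q ^ DIM('a))" by simp
    then show "?S \<le> 1/2"
      using V * by (simp only: mult_le_cancel_right) (auto simp: zero_less_mult_iff)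
  qed
qed

section \<open>Bessel symbols as mixtures of Gaussians\<close>

lemma nn_integral_Gamma_scaled:
  fixes p m :: real
  assumes p: "p > 0" and m: "m > 0"
  shows "(\<integral>\<^sup>+t. ennreal (indicator {0<..} t * t powr (p - 1) * exp (- t * m)) \<partial>lborel) = ennreal (Gamma p * m powr - p)"
proof -
  define f where "f t = indicator {0<..} t * t powr (p - 1) * exp (- t)" for t :: real
  have f_meas [measurable]: "f \<in> borel_measurable borel" unfolding f_def by measurable
  have f_nonneg: "f t \<ge> 0" for t by (simp add: f_def)
  \<comment> \<open>the origin may be dropped because \<open>0 powr a = 0\<close> for every exponent\<close>
  have f_eq: "indicator {0..} t * (t powr (p - 1) / exp t) = f t" for t
    by (auto simp: f_def indicator_def exp_minus field_simps)
  have "(\<integral>\<^sup>+t. ennreal (f t) \<partial>lborel) = ennreal (Gamma p)"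
    using nn_integral_has_integral_lebesgue[OF _ Gamma_integral_real[OF p]]
    unfolding f_eq by simp
  also have "(\<integral>\<^sup>+t. ennreal (f t) \<partial>lborel) = ennreal m * (\<integral>\<^sup>+t. ennreal (f (m * t)) \<partial>lborel)"
    using nn_integral_real_affine[of "\<lambda>t. ennreal (f t)" m 0] m by simp
  also have "\<dots> = (\<integral>\<^sup>+t. ennreal m * ennreal (f (m * t)) \<partial>lborel)"
    by (rule nn_integral_cmult[symmetric]) measurable
  also have "\<dots> = (\<integral>\<^sup>+t. ennreal (m powr p) * ennreal (indicator {0<..} t * t powr (p - 1) * exp (- t * m)) \<partial>lborel)"
  proof (intro nn_integral_cong)
    fix t :: real
    have "m * f (m * t) = m powr p * (indicator {0<..} t * t powr (p - 1) * exp (- t * m))"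
    proof (cases "t > 0")
      case True
      have "m * (m powr (p - 1)) = m powr p"
        using m powr_add[of m 1 "p - 1"] by simp
      then show ?thesis using m True by (simp add: f_def powr_mult mult_ac)
    next
      case False
      then have "\<not> 0 < m * t" using m by (simp add: zero_less_mult_iff)
      then show ?thesis using False by (simp add: f_def)
    qed
    then show "ennreal m * ennreal (f (m * t)) = ennreal (m powr p) * ennreal (indicator {0<..} t * t powr (p - 1) * exp (- t * m))"
      using m f_nonneg by (simp add: ennreal_mult[symmetric] del: mult_minus_left)
  qed
  also have "\<dots> = ennreal (m powr p) * (\<integral>\<^sup>+t. ennreal (indicator {0<..} t * t powr (p - 1) * exp (- t * m)) \<partial>lborel)"
    by (rule nn_integral_cmult) measurable
  finally have *: "ennreal (m powr p) * (\<integral>\<^sup>+t. ennreal (indicator {0<..} t * t powr (p - 1) * exp (- t * m)) \<partial>lborel) = ennreal (Gamma p)"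
    (is "_ * ?I = _") .
  have "?I = ennreal (m powr - p) * (ennreal (m powr p) * ?I)"
    using m by (simp add: mult.assoc[symmetric] ennreal_mult[symmetric] powr_add[symmetric])
  also have "\<dots> = ennreal (Gamma p * m powr - p)"
    unfolding * using p by (simp add: ennreal_mult[symmetric] Gamma_real_pos mult.commute less_imp_le)
  finally show ?thesis .
qed

text \<open>
  Gamma's integral writes \<open>(1 + |\<omega>|\<^sup>2) powr - p\<close> as a superposition of the Gaussians
  \<open>exp (- t |\<omega>|\<^sup>2)\<close> with weight \<open>t powr (p - 1) * exp (- t) / Gamma p\<close>. The exponent \<open>p\<close>
  occurs only in the weight, so integrals for different exponents can be compared in the single variable \<open>t\<close>.
\<close>

lemma bessel_symbol_as_gaussian_mixture:
  fixes h :: "'a::euclidean_space \<Rightarrow> ennreal" and p :: real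
  assumes p: "p > 0" and h [measurable]: "h \<in> borel_measurable borel"
  shows "(\<integral>\<^sup>+\<omega>. ennreal (Gamma p * (1 + (norm \<omega>)\<^sup>2) powr - p) * h \<omega> \<partial>lborel) =
    (\<integral>\<^sup>+t. ennreal (indicator {0<..} t * t powr (p - 1) * exp (- t)) *
       (\<integral>\<^sup>+\<omega>. ennreal (exp (- t * (norm \<omega>)\<^sup>2)) * h \<omega> \<partial>lborel) \<partial>lborel)"
proof -
  have "(\<integral>\<^sup>+\<omega>. ennreal (Gamma p * (1 + (norm \<omega>)\<^sup>2) powr - p) * h \<omega> \<partial>lborel)
    = (\<integral>\<^sup>+\<omega>. (\<integral>\<^sup>+t. ennreal (indicator {0<..} t * t powr (p - 1) * exp (- t * (1 + (norm \<omega>)\<^sup>2))) * h \<omega> \<partial>lborel) \<partial>lborel)"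
  proof (intro nn_integral_cong)
    fix \<omega> :: 'a
    have "1 + (norm \<omega>)\<^sup>2 > 0" by (simp add: add_pos_nonneg)
    note eq = nn_integral_Gamma_scaled[OF p this]
    show "ennreal (Gamma p * (1 + (norm \<omega>)\<^sup>2) powr - p) * h \<omega> =
      (\<integral>\<^sup>+t. ennreal (indicator {0<..} t * t powr (p - 1) * exp (- t * (1 + (norm \<omega>)\<^sup>2))) * h \<omega> \<partial>lborel)"
      unfolding eq[symmetric] by (rule nn_integral_multc[symmetric]) measurable
  qed
  also have "\<dots> = (\<integral>\<^sup>+\<omega>. (\<integral>\<^sup>+t. ennreal (indicator {0<..} t * t powr (p - 1) * exp (- t)) *
      (ennreal (exp (- t * (norm \<omega>)\<^sup>2)) * h \<omega>) \<partial>lborel) \<partial>lborel)"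
  proof (intro nn_integral_cong)
    fix \<omega> :: 'a and t :: real
    have "exp (- t * (1 + (norm \<omega>)\<^sup>2)) = exp (- t) * exp (- t * (norm \<omega>)\<^sup>2)"
      by (simp add: exp_add[symmetric] algebra_simps)
    then show "ennreal (indicator {0<..} t * t powr (p - 1) * exp (- t * (1 + (norm \<omega>)\<^sup>2))) * h \<omega> =
      ennreal (indicator {0<..} t * t powr (p - 1) * exp (- t)) * (ennreal (exp (- t * (norm \<omega>)\<^sup>2)) * h \<omega>)"
      by (simp add: ennreal_mult mult.assoc)
  qed
  also have "\<dots> = (\<integral>\<^sup>+t. (\<integral>\<^sup>+\<omega>. ennreal (indicator {0<..} t * t powr (p - 1) * exp (- t)) *
      (ennreal (exp (- t * (norm \<omega>)\<^sup>2)) * h \<omega>) \<partial>lborel) \<partial>lborel)"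
    by (rule lborel_pair.Fubini') measurable
  also have "\<dots> = (\<integral>\<^sup>+t. ennreal (indicator {0<..} t * t powr (p - 1) * exp (- t)) *
       (\<integral>\<^sup>+\<omega>. ennreal (exp (- t * (norm \<omega>)\<^sup>2)) * h \<omega> \<partial>lborel) \<partial>lborel)"
    by (intro nn_integral_cong nn_integral_cmult) measurable
  finally show ?thesis .
qed

lemma integrable_bessel_symbol:
  fixes p :: real
  assumes p: "p > real DIM('a::euclidean_space) / 2"
  shows "integrable lborel (\<lambda>\<omega>::'a. (1 + (norm \<omega>)\<^sup>2) powr - p)"
proof -
  let ?D = "real DIM('a) / 2"
  have p0: "p > 0" using p by (smt (verit) divide_nonneg_nonneg of_nat_0_le_iff)
  have "(\<integral>\<^sup>+\<omega>. ennreal (Gamma p * (1 + (norm (\<omega>::'a))\<^sup>2) powr - p) * 1 \<partial>lborel) =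
    (\<integral>\<^sup>+t. ennreal (indicator {0<..} t * t powr (p - 1) * exp (- t)) *
       (\<integral>\<^sup>+\<omega>. ennreal (exp (- t * (norm (\<omega>::'a))\<^sup>2)) * 1 \<partial>lborel) \<partial>lborel)"
    by (rule bessel_symbol_as_gaussian_mixture[OF p0]) simp
  also have "\<dots> = (\<integral>\<^sup>+t. ennreal (pi powr ?D) * ennreal (indicator {0<..} t * t powr ((p - ?D) - 1) * exp (- t * 1)) \<partial>lborel)"
  proof (intro nn_integral_cong)
    fix t :: real
    show "ennreal (indicator {0<..} t * t powr (p - 1) * exp (- t)) * (\<integral>\<^sup>+\<omega>. ennreal (exp (- t * (norm (\<omega>::'a))\<^sup>2)) * 1 \<partial>lborel)
      = ennreal (pi powr ?D) * ennreal (indicator {0<..} t * t powr ((p - ?D) - 1) * exp (- t * 1))"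
    proof (cases "t > 0")
      case True
      have "has_bochner_integral lborel (\<lambda>\<omega>::'a. exp (- t * (norm \<omega>)\<^sup>2)) ((pi / t) powr ?D)"
        using gaussian_fourier[OF True, of "0::'a"] by simp
      then have "(\<integral>\<^sup>+\<omega>. ennreal (exp (- t * (norm (\<omega>::'a))\<^sup>2)) \<partial>lborel) = ennreal ((pi / t) powr ?D)"
        using nn_integral_eq_integral[of lborel "\<lambda>\<omega>::'a. exp (- t * (norm \<omega>)\<^sup>2)"]
        by (simp add: has_bochner_integral_iff)
      moreover have eq: "t powr (p - 1) * exp (- t) * (pi / t) powr ?D = pi powr ?D * (t powr ((p - ?D) - 1) * exp (- t))"
      proof -
        have "(pi / t) powr ?D = pi powr ?D * t powr - ?D"
          using True by (simp add: powr_divide powr_minus field_simps)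
        moreover have "t powr ((p - ?D) - 1) = t powr (p - 1) * t powr - ?D"
          unfolding powr_add[symmetric] by (simp add: algebra_simps)
        ultimately show ?thesis by (simp only: mult_ac)
      qed
      moreover have "ennreal (t powr (p - 1) * exp (- t)) * ennreal ((pi / t) powr ?D) =
          ennreal (pi powr ?D) * ennreal (t powr ((p - ?D) - 1) * exp (- t))"
        by (subst (1 2) ennreal_mult[symmetric]) (simp_all only: eq, simp_all)
      ultimately show ?thesis
        using True by simp
    qed simp
  qed
  also have "\<dots> = ennreal (pi powr ?D) * ennreal (Gamma (p - ?D) * 1 powr - (p - ?D))"
    using p by (subst nn_integral_cmult) (measurable, subst nn_integral_Gamma_scaled, auto)
  also have "\<dots> < \<infinity>" by (simp add: ennreal_mult_less_top)
  finally have "integrable lborel (\<lambda>\<omega>::'a. Gamma p * (1 + (norm \<omega>)\<^sup>2) powr - p)"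
    using p0 by (intro integrableI_nonneg) (auto simp: Gamma_real_pos less_imp_le)
  then have "integrable lborel (\<lambda>\<omega>::'a. (Gamma p * (1 + (norm \<omega>)\<^sup>2) powr - p) / Gamma p)"
    by (rule integrable_divide)
  then show ?thesis using Gamma_real_pos[OF p0] by simp
qed

lemma integrable_bessel_symbol_cos:
  fixes p :: real and y :: "'a::euclidean_space"
  assumes p: "p > real DIM('a) / 2"
  shows "integrable lborel (\<lambda>\<omega>. (1 + (norm \<omega>)\<^sup>2) powr - p * cos (inner \<omega> y))"
proof (rule Bochner_Integration.integrable_bound[OF integrable_bessel_symbol[OF p]])
  show "AE \<omega> in lborel. norm ((1 + (norm \<omega>)\<^sup>2) powr - p * cos (inner \<omega> y)) \<le> norm ((1 + (norm \<omega>)\<^sup>2) powr - p)"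
    by (auto simp: abs_mult intro!: mult_left_le)
qed measurable

lemma nn_integral_powr_from_0:
  fixes s c :: real
  assumes "s > 0" "c \<ge> 0"
  shows "(\<integral>\<^sup>+t. ennreal (indicator {0<..c} t * t powr (s - 1)) \<partial>lborel) = ennreal (c powr s / s)"
proof -
  have eq: "indicator {0..c} t * t powr (s - 1) = indicator {0<..c} t * t powr (s - 1)" for t :: real
    by (auto simp: indicator_def)
  then show ?thesis
    using nn_integral_has_integral_lebesgue[OF _ has_integral_powr_from_0[of "s - 1" c]] assms
    unfolding eq by simp
qed

text \<open>
  Split at \<open>t0\<close>. For \<open>t > t0\<close> the two weights differ by \<open>t powr (a - \<tau>) \<le> t0 powr (a - \<tau>)\<close>.
  For \<open>t \<le> t0\<close> the integrand is known up to constants, as \<open>g t\<close> is comparable to \<open>B * t powr - \<delta>\<close>, and both integrals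
  are explicit: they are of orders \<open>B * t0 powr (a - \<delta>)\<close> and \<open>B * t0 powr (\<tau> - \<delta>)\<close>, with the same
  ratio \<open>t0 powr (a - \<tau>)\<close>. The condition \<open>\<delta> < a\<close> makes the first one converge.
\<close>

lemma gamma_weighted_comparison:
  fixes g :: "real \<Rightarrow> real"
  assumes \<delta>: "0 < \<delta>" "\<delta> < a" "a \<le> \<tau>" and t0: "0 < t0" "t0 \<le> 1" and B: "B \<ge> 0"
    and g [measurable]: "g \<in> borel_measurable borel" and g_nonneg: "\<And>t. t > 0 \<Longrightarrow> g t \<ge> 0"
    and lower: "\<And>t. 0 < t \<Longrightarrow> t \<le> t0 \<Longrightarrow> B / 2 * t powr - \<delta> \<le> g t"
    and upper: "\<And>t. 0 < t \<Longrightarrow> t \<le> t0 \<Longrightarrow> g t \<le> 3 / 2 * B * t powr - \<delta>"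
  shows "(\<integral>\<^sup>+t. ennreal (indicator {0<..} t * t powr (a - 1) * exp (- t) * g t) \<partial>lborel) \<le>
    ennreal ((1 + 3 * exp 1 * (\<tau> - \<delta>) / (a - \<delta>)) * t0 powr (a - \<tau>)) *
    (\<integral>\<^sup>+t. ennreal (indicator {0<..} t * t powr (\<tau> - 1) * exp (- t) * g t) \<partial>lborel)"
    (is "?Ia \<le> ennreal ((1 + ?C) * ?r) * ?I\<tau>")
proof -
  have C: "?C \<ge> 0" using \<delta> by simp
  have low: "ennreal (B / (2 * exp 1) * (t0 powr (\<tau> - \<delta>) / (\<tau> - \<delta>))) \<le> ?I\<tau>"
  proof -
    have "ennreal (B / (2 * exp 1) * (t0 powr (\<tau> - \<delta>) / (\<tau> - \<delta>)))
      = ennreal (B / (2 * exp 1)) * (\<integral>\<^sup>+t. ennreal (indicator {0<..t0} t * t powr ((\<tau> - \<delta>) - 1)) \<partial>lborel)"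
      using \<delta> t0 B by (subst nn_integral_powr_from_0) (auto simp: ennreal_mult[symmetric])
    also have "\<dots> = (\<integral>\<^sup>+t. ennreal (B / (2 * exp 1)) * ennreal (indicator {0<..t0} t * t powr ((\<tau> - \<delta>) - 1)) \<partial>lborel)"
      by (rule nn_integral_cmult[symmetric]) measurable
    also have "\<dots> \<le> ?I\<tau>"
    proof (intro nn_integral_mono)
      fix t :: real
      show "ennreal (B / (2 * exp 1)) * ennreal (indicator {0<..t0} t * t powr ((\<tau> - \<delta>) - 1)) \<le>
        ennreal (indicator {0<..} t * t powr (\<tau> - 1) * exp (- t) * g t)"
      proof (cases "0 < t \<and> t \<le> t0")
        case True
        have "B / (2 * exp 1) * t powr ((\<tau> - \<delta>) - 1) = t powr (\<tau> - 1) * (exp (- 1) * (B / 2 * t powr - \<delta>))"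
          using True by (simp add: powr_add powr_diff powr_minus exp_minus field_simps)
        also have "\<dots> \<le> t powr (\<tau> - 1) * (exp (- t) * g t)"
          using True t0 B lower[of t] by (intro mult_left_mono mult_mono) auto
        finally show ?thesis
          using True B by (simp add: ennreal_mult[symmetric] ennreal_leI mult_ac)
      qed (auto simp: indicator_def)
    qed
    finally show ?thesis .
  qed
  have "?Ia = (\<integral>\<^sup>+t. ennreal (indicator {0<..t0} t * t powr (a - 1) * exp (- t) * g t) +
      ennreal (indicator {t0<..} t * t powr (a - 1) * exp (- t) * g t) \<partial>lborel)"
    using t0 by (intro nn_integral_cong) (auto simp: indicator_def)
  also have "\<dots> = (\<integral>\<^sup>+t. ennreal (indicator {0<..t0} t * t powr (a - 1) * exp (- t) * g t) \<partial>lborel) +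
      (\<integral>\<^sup>+t. ennreal (indicator {t0<..} t * t powr (a - 1) * exp (- t) * g t) \<partial>lborel)"
    by (rule nn_integral_add) measurable
  also have "\<dots> \<le> ennreal (?C * ?r) * ?I\<tau> + ennreal ?r * ?I\<tau>"
  proof (rule add_mono)
    have "(\<integral>\<^sup>+t. ennreal (indicator {0<..t0} t * t powr (a - 1) * exp (- t) * g t) \<partial>lborel) \<le>
      (\<integral>\<^sup>+t. ennreal (3 / 2 * B) * ennreal (indicator {0<..t0} t * t powr ((a - \<delta>) - 1)) \<partial>lborel)"
    proof (intro nn_integral_mono)
      fix t :: real
      show "ennreal (indicator {0<..t0} t * t powr (a - 1) * exp (- t) * g t) \<le>
        ennreal (3 / 2 * B) * ennreal (indicator {0<..t0} t * t powr ((a - \<delta>) - 1))"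
      proof (cases "0 < t \<and> t \<le> t0")
        case True
        have "t powr (a - 1) * (exp (- t) * g t) \<le> t powr (a - 1) * (1 * (3 / 2 * B * t powr - \<delta>))"
          using True upper[of t] g_nonneg[of t] by (intro mult_left_mono mult_mono) auto
        also have "\<dots> = 3 / 2 * B * t powr ((a - \<delta>) - 1)"
          using True by (simp add: powr_add powr_diff powr_minus field_simps)
        finally show ?thesis
          using True B by (simp add: ennreal_mult[symmetric] ennreal_leI mult_ac)
      qed (auto simp: indicator_def)
    qed
    also have "\<dots> = ennreal (3 / 2 * B) * (\<integral>\<^sup>+t. ennreal (indicator {0<..t0} t * t powr ((a - \<delta>) - 1)) \<partial>lborel)"
      by (rule nn_integral_cmult) measurable
    also have "\<dots> = ennreal (3 / 2 * B * (t0 powr (a - \<delta>) / (a - \<delta>)))"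
      using \<delta> t0 B by (subst nn_integral_powr_from_0) (auto simp: ennreal_mult[symmetric])
    also have "3 / 2 * B * (t0 powr (a - \<delta>) / (a - \<delta>)) = ?C * ?r * (B / (2 * exp 1) * (t0 powr (\<tau> - \<delta>) / (\<tau> - \<delta>)))"
    proof -
      have "t0 powr (a - \<delta>) = ?r * t0 powr (\<tau> - \<delta>)" by (simp add: powr_add[symmetric])
      moreover have id: "3 / 2 * B * (R * T / u) = 3 * e * v / u * R * (B / (2 * e) * (T / v))"
        if "u \<noteq> 0" "v \<noteq> 0" "e \<noteq> 0" for R T u v e :: real
        using that by (simp add: field_simps)
      ultimately show ?thesis using \<delta> by (simp only:, intro id) auto
    qed
    also have "ennreal \<dots> = ennreal (?C * ?r) * ennreal (B / (2 * exp 1) * (t0 powr (\<tau> - \<delta>) / (\<tau> - \<delta>)))"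
      using C B \<delta> by (intro ennreal_mult) auto
    also have "\<dots> \<le> ennreal (?C * ?r) * ?I\<tau>"
      using low by (rule mult_left_mono) simp
    finally show "(\<integral>\<^sup>+t. ennreal (indicator {0<..t0} t * t powr (a - 1) * exp (- t) * g t) \<partial>lborel) \<le> ennreal (?C * ?r) * ?I\<tau>" .
    have "(\<integral>\<^sup>+t. ennreal (indicator {t0<..} t * t powr (a - 1) * exp (- t) * g t) \<partial>lborel) \<le>
      (\<integral>\<^sup>+t. ennreal ?r * ennreal (indicator {0<..} t * t powr (\<tau> - 1) * exp (- t) * g t) \<partial>lborel)"
    proof (intro nn_integral_mono)
      fix t :: real
      show "ennreal (indicator {t0<..} t * t powr (a - 1) * exp (- t) * g t) \<le>
        ennreal ?r * ennreal (indicator {0<..} t * t powr (\<tau> - 1) * exp (- t) * g t)"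
      proof (cases "t > t0")
        case True
        have "t powr (a - 1) = t powr (a - \<tau>) * t powr (\<tau> - 1)" by (simp add: powr_add[symmetric])
        also have "\<dots> \<le> ?r * t powr (\<tau> - 1)"
          using True t0 \<delta> by (intro mult_right_mono powr_mono2') auto
        finally have "t powr (a - 1) * (exp (- t) * g t) \<le> ?r * t powr (\<tau> - 1) * (exp (- t) * g t)"
          using g_nonneg[of t] True t0 by (intro mult_right_mono) auto
        then show ?thesis
          using True t0 g_nonneg[of t] by (simp add: ennreal_mult[symmetric] ennreal_leI mult_ac)
      qed (auto simp: indicator_def)
    qed
    also have "\<dots> = ennreal ?r * ?I\<tau>" by (rule nn_integral_cmult) measurable
    finally show "(\<integral>\<^sup>+t. ennreal (indicator {t0<..} t * t powr (a - 1) * exp (- t) * g t) \<partial>lborel) \<le> ennreal ?r * ?I\<tau>" .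
  qed
  also have "\<dots> = ennreal ((1 + ?C) * ?r) * ?I\<tau>"
  proof -
    have "ennreal ((1 + ?C) * ?r) = ennreal (?C * ?r + ?r)" by (simp only: distrib_right mult_1 add.commute)
    also have "\<dots> = ennreal (?C * ?r) + ennreal ?r" using C by (intro ennreal_plus mult_nonneg_nonneg powr_ge_zero)
    finally show ?thesis by (simp only: distrib_right)
  qed
  finally show ?thesis .
qed

section \<open>Spectral forms of exponential sums\<close>

text \<open>
  The squared modulus of the exponential sum with coefficients \<open>\<alpha> i\<close> and frequencies \<open>x i\<close>. By the
  Fourier representation, the quadratic form of a translation invariant kernel is the integral of this function against
  the Fourier transform of the kernel.
\<close>

definition exponential_sum_sq :: "nat \<Rightarrow> (nat \<Rightarrow> 'a::euclidean_space) \<Rightarrow> (nat \<Rightarrow> real) \<Rightarrow> 'a \<Rightarrow> real" where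
  "exponential_sum_sq n x \<alpha> \<omega> = (\<Sum>i<n. \<alpha> i * cos (inner \<omega> (x i)))\<^sup>2 + (\<Sum>i<n. \<alpha> i * sin (inner \<omega> (x i)))\<^sup>2"

lemma exponential_sum_sq_expand:
  "exponential_sum_sq n x \<alpha> \<omega> = (\<Sum>i<n. \<Sum>j<n. \<alpha> i * \<alpha> j * cos (inner \<omega> (x i - x j)))"
  by (simp add: exponential_sum_sq_def power2_eq_square sum_product sum.distrib[symmetric] inner_diff_right cos_diff
      algebra_simps)

lemma exponential_sum_sq_nonneg: "exponential_sum_sq n x \<alpha> \<omega> \<ge> 0"
  by (simp add: exponential_sum_sq_def)

lemma exponential_sum_sq_measurable [measurable]: "exponential_sum_sq n x \<alpha> \<in> borel_measurable borel"
  unfolding exponential_sum_sq_def by measurable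

lemma exponential_sum_sq_has_integral:
  assumes "\<And>y. has_bochner_integral M (\<lambda>\<omega>. w \<omega> * cos (inner \<omega> y)) (F y)"
  shows "has_bochner_integral M (\<lambda>\<omega>. w \<omega> * exponential_sum_sq n x \<alpha> \<omega>) (\<Sum>i<n. \<Sum>j<n. \<alpha> i * \<alpha> j * F (x i - x j))"
proof -
  have "has_bochner_integral M (\<lambda>\<omega>. \<Sum>i<n. \<Sum>j<n. \<alpha> i * \<alpha> j * (w \<omega> * cos (inner \<omega> (x i - x j))))
    (\<Sum>i<n. \<Sum>j<n. \<alpha> i * \<alpha> j * F (x i - x j))"
    by (intro has_bochner_integral_sum has_bochner_integral_mult_right assms)
  then show ?thesis
    by (simp add: exponential_sum_sq_expand sum_distrib_left mult_ac)
qed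

lemma bessel_form_has_integral:
  fixes x :: "nat \<Rightarrow> 'a::euclidean_space"
  assumes p: "p > real DIM('a) / 2"
  shows "has_bochner_integral lborel (\<lambda>\<omega>. (1 + (norm \<omega>)\<^sup>2) powr - p * exponential_sum_sq n x \<alpha> \<omega>)
    (\<Sum>i<n. \<Sum>j<n. \<alpha> i * \<alpha> j * (LBINT \<omega>. (1 + (norm \<omega>)\<^sup>2) powr - p * cos (inner \<omega> (x i - x j))))"
proof (rule exponential_sum_sq_has_integral)
  show "has_bochner_integral lborel (\<lambda>\<omega>. (1 + (norm \<omega>)\<^sup>2) powr - p * cos (inner \<omega> y))
      (LBINT \<omega>. (1 + (norm \<omega>)\<^sup>2) powr - p * cos (inner \<omega> y))" for y :: 'a
    using integrable_bessel_symbol_cos[OF p] by (simp add: has_bochner_integral_iff)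
qed

lemmas integrable_bessel_form = integrable.intros[OF bessel_form_has_integral]

text \<open>
  For wide Gaussians (small \<open>t\<close>) the exponential functions belonging to separated points are almost
  orthogonal: the form is comparable to \<open>t powr - (d/2)\<close> times the squared norm of the coefficients.
\<close>

lemma gaussian_form_bounds:
  fixes x :: "nat \<Rightarrow> 'a::euclidean_space"
  assumes small: "\<And>i. i < n \<Longrightarrow> (\<Sum>j\<in>{..<n} - {i}. exp (- (norm (x j - x i))\<^sup>2 / (4 * t))) \<le> 1/2"
    and t: "t > 0"
  shows "pi powr (real DIM('a) / 2) * (\<Sum>i<n. (\<alpha> i)\<^sup>2) / 2 * t powr - (real DIM('a) / 2)
      \<le> (\<Sum>i<n. \<Sum>j<n. \<alpha> i * \<alpha> j * ((pi / t) powr (real DIM('a) / 2) * exp (- (norm (x i - x j))\<^sup>2 / (4 * t))))" (is "?L \<le> ?M")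
    and "(\<Sum>i<n. \<Sum>j<n. \<alpha> i * \<alpha> j * ((pi / t) powr (real DIM('a) / 2) * exp (- (norm (x i - x j))\<^sup>2 / (4 * t))))
      \<le> 3 / 2 * (pi powr (real DIM('a) / 2) * (\<Sum>i<n. (\<alpha> i)\<^sup>2)) * t powr - (real DIM('a) / 2)" (is "_ \<le> ?U")
proof -
  let ?D = "real DIM('a) / 2"
  define K where "K i j = exp (- (norm (x i - x j))\<^sup>2 / (4 * t))" for i j
  define A where "A = (\<Sum>i<n. (\<alpha> i)\<^sup>2)"
  define S where "S = (\<Sum>i<n. \<Sum>j<n. \<alpha> i * \<alpha> j * K i j)"
  have "\<bar>S - A\<bar> \<le> 1/2 * A"
    unfolding A_def S_def
    by (rule quadratic_form_diagonally_dominant) (use small in \<open>auto simp: K_def norm_minus_commute\<close>)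
  then have SA: "A / 2 \<le> S" "S \<le> 3 / 2 * A" by linarith+
  have pt: "(pi / t) powr ?D = pi powr ?D * t powr - ?D"
    using t by (simp add: powr_divide powr_minus field_simps)
  have "?M = (pi / t) powr ?D * S"
    by (simp add: S_def K_def sum_distrib_left mult_ac)
  then have M: "?M = pi powr ?D * t powr - ?D * S" by (simp only: pt)
  have "pi powr ?D * t powr - ?D * (A / 2) \<le> pi powr ?D * t powr - ?D * S"
    using SA(1) by (rule mult_left_mono) simp
  then show "?L \<le> ?M" unfolding M A_def[symmetric] by (simp add: mult_ac)
  have "pi powr ?D * t powr - ?D * S \<le> pi powr ?D * t powr - ?D * (3 / 2 * A)"
    using SA(2) by (rule mult_left_mono) simp
  then show "?M \<le> ?U" unfolding M A_def[symmetric] by (simp add: mult_ac)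
qed

text \<open>
  With \<open>P\<close> for the squared exponential sum and \<open>g t\<close> for its integral against \<open>exp (- t |\<omega>|\<^sup>2)\<close>, both sides are
  integrals of \<open>exp (- t) * g t\<close> against \<open>t powr (a - 1)\<close> and \<open>t powr (\<tau> - 1)\<close>. Almost orthogonality
  controls \<open>g\<close> up to \<open>t0 = \<kappa> q\<^sup>2\<close>, and the one-dimensional comparison loses the factor
  \<open>t0 powr (a - \<tau>)\<close>, which is a constant times \<open>q powr (- 2 (\<tau> - a))\<close>.
\<close>

lemma bessel_form_comparison:
  fixes a \<tau> :: real
  assumes a: "real DIM('a::euclidean_space) / 2 < a" "a \<le> \<tau>"
  shows "\<exists>C>0. \<forall>n (x :: nat \<Rightarrow> 'a) \<alpha> q. 0 < q \<and> q \<le> 1 \<and>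
      (\<forall>i<n. \<forall>j<n. i \<noteq> j \<longrightarrow> q \<le> norm (x i - x j)) \<longrightarrow>
      (LBINT \<omega>. (1 + (norm \<omega>)\<^sup>2) powr - a * exponential_sum_sq n x \<alpha> \<omega>) \<le>
      C * q powr (- (2 * (\<tau> - a))) * (LBINT \<omega>. (1 + (norm \<omega>)\<^sup>2) powr - \<tau> * exponential_sum_sq n x \<alpha> \<omega>)"
proof -
  let ?D = "real DIM('a) / 2"
  have D: "0 < ?D" by simp
  obtain \<kappa> where \<kappa>: "0 < \<kappa>" "\<kappa> \<le> 1" and packing:
    "\<And>X z q t. finite X \<Longrightarrow> z \<notin> X \<Longrightarrow> q > 0 \<Longrightarrow> 0 < t \<Longrightarrow> t \<le> \<kappa> * q\<^sup>2 \<Longrightarrow>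
     (\<forall>x\<in>insert z X. \<forall>y\<in>insert z X. x \<noteq> y \<longrightarrow> q \<le> norm (x - y)) \<Longrightarrow>
     (\<Sum>x\<in>X. exp (- (norm (x - z :: 'a))\<^sup>2 / (4 * t))) \<le> 1/2"
    using gaussian_sum_le_half[where 'a='a] by metis
  define c where "c = 1 + 3 * exp 1 * (\<tau> - ?D) / (a - ?D)"
  have c: "c > 0" using a unfolding c_def by (intro add_pos_nonneg divide_nonneg_nonneg) auto
  have pos: "a > 0" "\<tau> > 0" using a D by linarith+
  define C where "C = c * \<kappa> powr (a - \<tau>) * Gamma \<tau> / Gamma a"
  have C: "C > 0" using c \<kappa> pos by (simp add: C_def Gamma_real_pos)
  show ?thesis
  proof (intro exI[of _ C] conjI C allI impI, elim conjE)
    fix n and x :: "nat \<Rightarrow> 'a" and \<alpha> :: "nat \<Rightarrow> real" and q :: real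
    assume q: "0 < q" "q \<le> 1" and sep: "\<forall>i<n. \<forall>j<n. i \<noteq> j \<longrightarrow> q \<le> norm (x i - x j)"
    define P where "P = exponential_sum_sq n x \<alpha>"
    have P [measurable]: "P \<in> borel_measurable borel" and P_nonneg: "P \<omega> \<ge> 0" for \<omega>
      unfolding P_def by (auto intro: exponential_sum_sq_nonneg)
    define g where "g t = (\<Sum>i<n. \<Sum>j<n. \<alpha> i * \<alpha> j * ((pi / t) powr ?D * exp (- (norm (x i - x j))\<^sup>2 / (4 * t))))" for t
    have g_meas [measurable]: "g \<in> borel_measurable borel" unfolding g_def by measurable
    have g: "has_bochner_integral lborel (\<lambda>\<omega>. exp (- t * (norm \<omega>)\<^sup>2) * P \<omega>) (g t)" if "t > 0" for t
      unfolding P_def g_def by (rule exponential_sum_sq_has_integral[OF gaussian_fourier[OF that]])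
    have g_nonneg: "g t \<ge> 0" if "t > 0" for t
    proof -
      have "0 \<le> (LBINT \<omega>. exp (- t * (norm \<omega>)\<^sup>2) * P \<omega>)"
        using P_nonneg by (intro integral_nonneg_AE) auto
      then show ?thesis using g[OF that] by (simp add: has_bochner_integral_iff)
    qed
    have nn_g: "(\<integral>\<^sup>+\<omega>. ennreal (exp (- t * (norm \<omega>)\<^sup>2)) * ennreal (P \<omega>) \<partial>lborel) = ennreal (g t)" if "t > 0" for t
    proof -
      have "(\<integral>\<^sup>+\<omega>. ennreal (exp (- t * (norm \<omega>)\<^sup>2) * P \<omega>) \<partial>lborel) = ennreal (g t)"
        using nn_integral_eq_integral[of lborel "\<lambda>\<omega>. exp (- t * (norm \<omega>)\<^sup>2) * P \<omega>"] g[OF that] P_nonneg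
        by (simp add: has_bochner_integral_iff)
      then show ?thesis using P_nonneg by (simp add: ennreal_mult)
    qed
    define E where "E p = (LBINT \<omega>. (1 + (norm \<omega>)\<^sup>2) powr - p * P \<omega>)" for p
    have E: "(\<integral>\<^sup>+t. ennreal (indicator {0<..} t * t powr (p - 1) * exp (- t) * g t) \<partial>lborel) = ennreal (Gamma p * E p)"
      if p: "p > ?D" for p
    proof -
      have p0: "p > 0" using p D by linarith
      have int: "integrable lborel (\<lambda>\<omega>. (1 + (norm \<omega>)\<^sup>2) powr - p * P \<omega>)"
        unfolding P_def by (rule integrable_bessel_form[OF p])
      have "(\<integral>\<^sup>+t. ennreal (indicator {0<..} t * t powr (p - 1) * exp (- t) * g t) \<partial>lborel) =
        (\<integral>\<^sup>+t. ennreal (indicator {0<..} t * t powr (p - 1) * exp (- t)) *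
          (\<integral>\<^sup>+\<omega>. ennreal (exp (- t * (norm \<omega>)\<^sup>2)) * ennreal (P \<omega>) \<partial>lborel) \<partial>lborel)"
      proof (intro nn_integral_cong)
        fix t :: real
        show "ennreal (indicator {0<..} t * t powr (p - 1) * exp (- t) * g t) =
          ennreal (indicator {0<..} t * t powr (p - 1) * exp (- t)) *
          (\<integral>\<^sup>+\<omega>. ennreal (exp (- t * (norm \<omega>)\<^sup>2)) * ennreal (P \<omega>) \<partial>lborel)"
          by (cases "t > 0") (simp_all only: nn_g, simp_all add: ennreal_mult g_nonneg)
      qed
      also have "\<dots> = (\<integral>\<^sup>+\<omega>. ennreal (Gamma p * (1 + (norm \<omega>)\<^sup>2) powr - p) * ennreal (P \<omega>) \<partial>lborel)"
        by (rule bessel_symbol_as_gaussian_mixture[OF p0, symmetric]) measurable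
      also have "\<dots> = (\<integral>\<^sup>+\<omega>. ennreal (Gamma p * ((1 + (norm \<omega>)\<^sup>2) powr - p * P \<omega>)) \<partial>lborel)"
        using P_nonneg Gamma_real_pos[OF p0] by (simp add: ennreal_mult[symmetric] mult.assoc)
      also have "\<dots> = ennreal (Gamma p * E p)"
        using P_nonneg Gamma_real_pos[OF p0] int
        by (subst nn_integral_eq_integral) (auto simp: E_def)
      finally show ?thesis .
    qed
    have E_nonneg: "E p \<ge> 0" for p
      unfolding E_def using P_nonneg by (intro integral_nonneg_AE) auto
    define t0 where "t0 = \<kappa> * q\<^sup>2"
    have t0: "0 < t0" "t0 \<le> 1"
      using \<kappa> q by (auto simp: t0_def intro!: mult_le_one power_le_one)
    have small: "(\<Sum>j\<in>{..<n} - {i}. exp (- (norm (x j - x i))\<^sup>2 / (4 * t))) \<le> 1/2"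
      if t: "0 < t" "t \<le> t0" and i: "i < n" for t i
    proof -
      have neq: "x j \<noteq> x k" if "j < n" "k < n" "j \<noteq> k" for j k
        using sep that q by force
      have "(\<Sum>y\<in>x ` ({..<n} - {i}). exp (- (norm (y - x i))\<^sup>2 / (4 * t))) \<le> 1/2"
      proof (rule packing[where q=q])
        have sep': "q \<le> norm (x j - x k)" if "j < n" "k < n" "x j \<noteq> x k" for j k
          using sep that by metis
        show "\<forall>y\<in>insert (x i) (x ` ({..<n} - {i})). \<forall>z\<in>insert (x i) (x ` ({..<n} - {i})). y \<noteq> z \<longrightarrow> q \<le> norm (y - z)"
          using i sep' by auto
      qed (use t q i neq in \<open>auto simp: t0_def\<close>)
      also have "(\<Sum>y\<in>x ` ({..<n} - {i}). exp (- (norm (y - x i))\<^sup>2 / (4 * t)))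
        = (\<Sum>j\<in>{..<n} - {i}. exp (- (norm (x j - x i))\<^sup>2 / (4 * t)))"
        by (subst sum.reindex) (use neq in \<open>auto simp: inj_on_def\<close>)
      finally show ?thesis .
    qed
    define B where "B = pi powr ?D * (\<Sum>i<n. (\<alpha> i)\<^sup>2)"
    have B: "B \<ge> 0" unfolding B_def by (intro mult_nonneg_nonneg sum_nonneg) auto
    have bounds: "B / 2 * t powr - ?D \<le> g t" "g t \<le> 3 / 2 * B * t powr - ?D" if "0 < t" "t \<le> t0" for t
      unfolding g_def B_def using gaussian_form_bounds[of n x t \<alpha>, OF small[OF that]] that by auto
    have "ennreal (Gamma a * E a) \<le> ennreal (c * t0 powr (a - \<tau>)) * ennreal (Gamma \<tau> * E \<tau>)"
      using gamma_weighted_comparison[OF D a t0 B g_meas g_nonneg bounds] a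
      by (simp only: c_def E order_less_le_trans)
    also have "\<dots> = ennreal (c * t0 powr (a - \<tau>) * (Gamma \<tau> * E \<tau>))"
      using c E_nonneg pos by (simp add: ennreal_mult Gamma_real_pos less_imp_le)
    finally have "Gamma a * E a \<le> c * t0 powr (a - \<tau>) * (Gamma \<tau> * E \<tau>)"
      using c E_nonneg pos by (subst (asm) ennreal_le_iff) (auto simp: Gamma_real_pos less_imp_le)
    then have "E a \<le> c * t0 powr (a - \<tau>) * (Gamma \<tau> * E \<tau>) / Gamma a"
      using Gamma_real_pos[OF pos(1)] by (simp add: field_simps)
    also have "t0 powr (a - \<tau>) = \<kappa> powr (a - \<tau>) * q powr (- (2 * (\<tau> - a)))"
      using \<kappa> q by (simp add: t0_def powr_mult power2_powr algebra_simps)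
    finally show "(LBINT \<omega>. (1 + (norm \<omega>)\<^sup>2) powr - a * exponential_sum_sq n x \<alpha> \<omega>) \<le>
      C * q powr (- (2 * (\<tau> - a))) * (LBINT \<omega>. (1 + (norm \<omega>)\<^sup>2) powr - \<tau> * exponential_sum_sq n x \<alpha> \<omega>)"
      unfolding E_def P_def C_def by (simp add: mult_ac)
  qed
qed

section \<open>Kernel matrices\<close>

lemma rayleigh_quotient_kernel_matrix:
  assumes \<alpha>: "\<alpha> \<in> carrier_vec (length xs)"
  shows "rayleigh_quotient (kernel_matrix k xs) \<alpha> =
    (\<Sum>i<length xs. \<Sum>j<length xs. vec_index \<alpha> i * vec_index \<alpha> j * k (xs ! i) (xs ! j)) /
    (\<Sum>i<length xs. (vec_index \<alpha> i)\<^sup>2)"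
proof -
  have dim: "dim_vec \<alpha> = length xs" using \<alpha> by simp
  have "scalar_prod \<alpha> (kernel_matrix k xs *\<^sub>v \<alpha>) =
      (\<Sum>i<length xs. \<Sum>j<length xs. vec_index \<alpha> i * vec_index \<alpha> j * k (xs ! i) (xs ! j))"
    using dim by (simp add: kernel_matrix_def scalar_prod_def sum_distrib_left atLeast0LessThan mult_ac)
  moreover have "scalar_prod \<alpha> \<alpha> = (\<Sum>i<length xs. (vec_index \<alpha> i)\<^sup>2)"
    using dim by (simp add: scalar_prod_def power2_eq_square atLeast0LessThan)
  ultimately show ?thesis by (simp add: rayleigh_quotient_def)
qed

lemma finite_pairwise_distances:
  "finite X \<Longrightarrow> finite {norm (x - z) | x z. x \<in> X \<and> z \<in> X \<and> x \<noteq> z}"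
  by (rule finite_subset[of _ "(\<lambda>(x, z). norm (x - z)) ` (X \<times> X)"]) auto

lemma separation_distance_le:
  "finite X \<Longrightarrow> x \<in> X \<Longrightarrow> z \<in> X \<Longrightarrow> x \<noteq> z \<Longrightarrow> separation_distance X \<le> norm (x - z)"
  unfolding separation_distance_def by (intro Min_le finite_pairwise_distances) auto

lemma separation_distance_attained:
  assumes "finite X" "\<exists>x\<in>X. \<exists>z\<in>X. x \<noteq> z"
  obtains x z where "x \<in> X" "z \<in> X" "x \<noteq> z" "separation_distance X = norm (x - z)"
proof -
  have "separation_distance X \<in> {norm (x - z) | x z. x \<in> X \<and> z \<in> X \<and> x \<noteq> z}"
    unfolding separation_distance_def
    by (intro Min_in finite_pairwise_distances) (use assms in auto)
  then show thesis using that by auto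
qed

text \<open>
  The kernel is real, so only the real part of its Fourier integral survives, and the exponential becomes a cosine.
  Integrability of the symbol makes the integral a genuine one, through which real parts and finite sums pass.
\<close>

lemma kernel_form_eq_spectral_integral:
  fixes \<Phi> \<Phi>hat :: "real^'d \<Rightarrow> real"
  assumes ft: "has_fourier_transform \<Phi> \<Phi>hat" and hat: "\<And>\<omega>. \<Phi>hat \<omega> = (1 + (norm \<omega>)\<^sup>2) powr - p"
    and p: "p > real CARD('d) / 2"
  shows "(\<Sum>i<n. \<Sum>j<n. \<alpha> i * \<alpha> j * \<Phi> (x i - x j)) =
    (2 * pi) powr (- (real CARD('d) / 2)) * (LBINT \<omega>. (1 + (norm \<omega>)\<^sup>2) powr - p * exponential_sum_sq n x \<alpha> \<omega>)"
proof -
  let ?c = "(2 * pi) powr (- (real CARD('d) / 2))"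
  have p': "p > real DIM(real^'d) / 2" using p by simp
  define F where "F y = (LBINT \<omega>. (1 + (norm \<omega>)\<^sup>2) powr - p * cos (inner \<omega> y))" for y :: "real^'d"
  have \<Phi>: "\<Phi> y = ?c * F y" for y
  proof -
    let ?f = "\<lambda>\<omega>. complex_of_real (\<Phi>hat \<omega>) * exp (\<i> * complex_of_real (inner \<omega> y))"
    have "integrable lborel ?f"
    proof (rule Bochner_Integration.integrable_bound[OF integrable_bessel_symbol[OF p']])
      show "?f \<in> borel_measurable lborel" unfolding hat by measurable
    qed (simp add: norm_mult hat)
    then have "Re (integral\<^sup>L lborel ?f) = F y"
      unfolding F_def by (subst integral_Re[symmetric]) (simp_all add: hat Re_exp)
    moreover have "complex_of_real (\<Phi> y) = complex_of_real ?c * integral\<^sup>L lborel ?f"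
      using ft unfolding has_fourier_transform_def by blast
    then have "Re (complex_of_real (\<Phi> y)) = Re (complex_of_real ?c * integral\<^sup>L lborel ?f)"
      by (rule arg_cong)
    then have "\<Phi> y = ?c * Re (integral\<^sup>L lborel ?f)"
      by (simp only: times_complex.sel Re_complex_of_real Im_complex_of_real mult_zero_left diff_zero)
    ultimately show ?thesis by simp
  qed
  have "(LBINT \<omega>. (1 + (norm \<omega>)\<^sup>2) powr - p * exponential_sum_sq n x \<alpha> \<omega>) = (\<Sum>i<n. \<Sum>j<n. \<alpha> i * \<alpha> j * F (x i - x j))"
    using bessel_form_has_integral[OF p', of n x \<alpha>] by (simp add: has_bochner_integral_iff F_def)
  then show ?thesis by (simp add: \<Phi> sum_distrib_left mult_ac)
qed

lemma bessel_form_antimono: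
  fixes x :: "nat \<Rightarrow> 'a::euclidean_space"
  assumes "real DIM('a) / 2 < a" "a \<le> \<tau>"
  shows "(LBINT \<omega>. (1 + (norm \<omega>)\<^sup>2) powr - \<tau> * exponential_sum_sq n x \<alpha> \<omega>) \<le>
    (LBINT \<omega>. (1 + (norm \<omega>)\<^sup>2) powr - a * exponential_sum_sq n x \<alpha> \<omega>)"
proof (rule integral_mono)
  show "integrable lborel (\<lambda>\<omega>. (1 + (norm \<omega>)\<^sup>2) powr - \<tau> * exponential_sum_sq n x \<alpha> \<omega>)"
    "integrable lborel (\<lambda>\<omega>. (1 + (norm \<omega>)\<^sup>2) powr - a * exponential_sum_sq n x \<alpha> \<omega>)"
    using assms by (auto intro!: integrable_bessel_form)
  show "(1 + (norm \<omega>)\<^sup>2) powr - \<tau> * exponential_sum_sq n x \<alpha> \<omega> \<le> (1 + (norm \<omega>)\<^sup>2) powr - a * exponential_sum_sq n x \<alpha> \<omega>" for \<omega>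
    using assms by (intro mult_right_mono powr_mono exponential_sum_sq_nonneg) auto
qed

text \<open>
  Converts the truncated distance \<open>min q 1\<close> of the spectral estimate into the factor of the theorem: for \<open>q \<le> 1\<close>
  the factor \<open>(q\<^sup>2 + c\<^sup>2) powr h\<close> is at least \<open>c powr (2 h)\<close>, and for \<open>q > 1\<close> it
  absorbs \<open>q powr (- (2 * h))\<close>.
\<close>

lemma truncated_distance_powr_le:
  fixes q c h :: real
  assumes q: "q > 0" and c: "c > 0" and h: "h \<ge> 0"
  shows "(min q 1) powr (- (2 * h)) \<le> (1 + (c\<^sup>2) powr - h) * (q\<^sup>2 + c\<^sup>2) powr h * q powr (- (2 * h))"
proof (cases "q \<le> 1")
  case True
  have "1 = (c\<^sup>2) powr - h * (c\<^sup>2) powr h" using c by (simp add: powr_add[symmetric])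
  also have "\<dots> \<le> (1 + (c\<^sup>2) powr - h) * (q\<^sup>2 + c\<^sup>2) powr h"
    using h by (intro mult_mono powr_mono2) auto
  finally have "1 * q powr (- (2 * h)) \<le> (1 + (c\<^sup>2) powr - h) * (q\<^sup>2 + c\<^sup>2) powr h * q powr (- (2 * h))"
    by (rule mult_right_mono) simp
  then show ?thesis using True by simp
next
  case False
  have "1 = (q\<^sup>2) powr h * q powr (- (2 * h))"
    using q by (simp add: power2_powr powr_add[symmetric])
  also have "\<dots> \<le> (1 + (c\<^sup>2) powr - h) * (q\<^sup>2 + c\<^sup>2) powr h * q powr (- (2 * h))"
  proof (rule mult_right_mono)
    have "1 * (q\<^sup>2) powr h \<le> (1 + (c\<^sup>2) powr - h) * (q\<^sup>2 + c\<^sup>2) powr h"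
      using h by (intro mult_mono powr_mono2) auto
    then show "(q\<^sup>2) powr h \<le> (1 + (c\<^sup>2) powr - h) * (q\<^sup>2 + c\<^sup>2) powr h" by simp
  qed simp
  finally show ?thesis using False by (simp add: min_def)
qed

theorem theorem9:
  fixes \<Omega> :: "(real^'d) set" and \<tau> \<sigma> :: real
    and k k\<^sub>\<sigma> :: "real^'d \<Rightarrow> real^'d \<Rightarrow> real"
    and \<Phi> \<Phi>\<^sub>\<sigma> \<Phi>hat \<Phi>hat\<^sub>\<sigma> :: "real^'d \<Rightarrow> real"
  assumes tau: "\<tau> > real CARD('d) / 2"
    and sigma: "\<sigma> \<in> {real CARD('d) / (2 * \<tau>) <.. 1}"
    and k: "\<And>x z. k x z = \<Phi> (x - z)"
    and k\<^sub>\<sigma>: "\<And>x z. k\<^sub>\<sigma> x z = \<Phi>\<^sub>\<sigma> (x - z)"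
    and ft: "has_fourier_transform \<Phi> \<Phi>hat"
    and ft\<^sub>\<sigma>: "has_fourier_transform \<Phi>\<^sub>\<sigma> \<Phi>hat\<^sub>\<sigma>"
    and hat: "\<And>\<omega>. \<Phi>hat \<omega> = (1 + (norm \<omega>)\<^sup>2) powr (- \<tau>)"
    and hat\<^sub>\<sigma>: "\<And>\<omega>. \<Phi>hat\<^sub>\<sigma> \<omega> = (1 + (norm \<omega>)\<^sup>2) powr (- (\<sigma> * \<tau>))"
  shows "c0 TYPE('d) > 0 \<and>
    (\<exists>c>0. \<forall>xs \<alpha>. distinct xs \<and> length xs \<ge> 2 \<and> set xs \<subseteq> \<Omega> \<and>
        \<alpha> \<in> carrier_vec (length xs) \<and> \<alpha> \<noteq> 0\<^sub>v (length xs) \<longrightarrow>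
        (let q = separation_distance (set xs);
             A = kernel_matrix k xs; A\<^sub>\<sigma> = kernel_matrix k\<^sub>\<sigma> xs
         in rayleigh_quotient A \<alpha> \<le> rayleigh_quotient A\<^sub>\<sigma> \<alpha> \<and>
            rayleigh_quotient A\<^sub>\<sigma> \<alpha> \<le>
              c * (q\<^sup>2 + (c0 TYPE('d))\<^sup>2) powr ((1 - \<sigma>) * \<tau>) * q powr (- ((1 - \<sigma>) * 2 * \<tau>)) *
              rayleigh_quotient A \<alpha>)) \<and>
    (bounded \<Omega> \<longrightarrow>
      (\<exists>c'>0. \<forall>xs \<alpha>. distinct xs \<and> length xs \<ge> 2 \<and> set xs \<subseteq> \<Omega> \<and>
        \<alpha> \<in> carrier_vec (length xs) \<and> \<alpha> \<noteq> 0\<^sub>v (length xs) \<longrightarrow>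
        (let q = separation_distance (set xs);
             A = kernel_matrix k xs; A\<^sub>\<sigma> = kernel_matrix k\<^sub>\<sigma> xs
         in rayleigh_quotient A \<alpha> \<le> rayleigh_quotient A\<^sub>\<sigma> \<alpha> \<and>
            rayleigh_quotient A\<^sub>\<sigma> \<alpha> \<le>
              c' * q powr (- ((1 - \<sigma>) * 2 * \<tau>)) * rayleigh_quotient A \<alpha>)))"
proof -
  let ?c0 = "c0 TYPE('d)" and ?h = "(1 - \<sigma>) * \<tau>" and ?D = "real CARD('d) / 2"
  have D: "?D > 0" by simp
  have tau0: "\<tau> > 0" using tau D by linarith
  have \<sigma>\<tau>: "?D < \<sigma> * \<tau>" "\<sigma> * \<tau> \<le> \<tau>" and h: "?h \<ge> 0"
    using sigma tau0 by (auto simp: field_simps)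
  obtain C where C: "C > 0" and comparison:
    "\<And>n (x :: nat \<Rightarrow> real^'d) \<alpha> q. 0 < q \<Longrightarrow> q \<le> 1 \<Longrightarrow>
      (\<forall>i<n. \<forall>j<n. i \<noteq> j \<longrightarrow> q \<le> norm (x i - x j)) \<Longrightarrow>
      (LBINT \<omega>. (1 + (norm \<omega>)\<^sup>2) powr - (\<sigma> * \<tau>) * exponential_sum_sq n x \<alpha> \<omega>) \<le>
      C * q powr (- (2 * (\<tau> - \<sigma> * \<tau>))) * (LBINT \<omega>. (1 + (norm \<omega>)\<^sup>2) powr - \<tau> * exponential_sum_sq n x \<alpha> \<omega>)"
    using bessel_form_comparison[where 'a="real^'d", of "\<sigma> * \<tau>" \<tau>] \<sigma>\<tau> by auto
  define c where "c = C * (1 + (?c0\<^sup>2) powr - ?h)"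
  have c: "c > 0" using C unfolding c_def by (intro mult_pos_pos add_pos_nonneg) auto
  have main: "rayleigh_quotient (kernel_matrix k xs) \<alpha> \<le> rayleigh_quotient (kernel_matrix k\<^sub>\<sigma> xs) \<alpha> \<and>
      rayleigh_quotient (kernel_matrix k\<^sub>\<sigma> xs) \<alpha> \<le>
        c * (q\<^sup>2 + ?c0\<^sup>2) powr ?h * q powr (- ((1 - \<sigma>) * 2 * \<tau>)) * rayleigh_quotient (kernel_matrix k xs) \<alpha> \<and>
      0 \<le> rayleigh_quotient (kernel_matrix k xs) \<alpha> \<and>
      (\<exists>x\<in>set xs. \<exists>z\<in>set xs. q = norm (x - z))"
    if xs: "distinct xs" "length xs \<ge> 2" and \<alpha>: "\<alpha> \<in> carrier_vec (length xs)"
      and q_def: "q = separation_distance (set xs)" for xs \<alpha> q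
  proof -
    define n where "n = length xs"
    define x where "x i = xs ! i" for i
    define E where "E p = (LBINT \<omega>. (1 + (norm \<omega>)\<^sup>2) powr - p * exponential_sum_sq n x (vec_index \<alpha>) \<omega>)" for p
    define s where "s = (2 * pi) powr (- ?D) / (\<Sum>i<n. (vec_index \<alpha> i)\<^sup>2)"
    have s: "s \<ge> 0" unfolding s_def by (intro divide_nonneg_nonneg sum_nonneg) auto
    have rq: "rayleigh_quotient (kernel_matrix k xs) \<alpha> = s * E \<tau>"
      "rayleigh_quotient (kernel_matrix k\<^sub>\<sigma> xs) \<alpha> = s * E (\<sigma> * \<tau>)"
      using kernel_form_eq_spectral_integral[OF ft hat tau, of "vec_index \<alpha>" x n]
        kernel_form_eq_spectral_integral[OF ft\<^sub>\<sigma> hat\<^sub>\<sigma> \<sigma>\<tau>(1), of "vec_index \<alpha>" x n]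
      by (simp_all add: rayleigh_quotient_kernel_matrix[OF \<alpha>] k k\<^sub>\<sigma> E_def s_def n_def x_def)
    have "xs ! 0 \<noteq> xs ! 1" using xs by (subst nth_eq_iff_index_eq) auto
    moreover have "xs ! 0 \<in> set xs" "xs ! 1 \<in> set xs" using xs by (auto intro!: nth_mem)
    ultimately obtain y z where yz: "y \<in> set xs" "z \<in> set xs" "y \<noteq> z" "q = norm (y - z)"
      unfolding q_def by (metis separation_distance_attained List.finite_set)
    then have q: "q > 0" by simp
    \<comment> \<open>truncation keeps \<open>t0 \<le> 1\<close>, so that \<open>exp (- t)\<close> is bounded below near the origin\<close>
    have sep: "min q 1 \<le> norm (x i - x j)" if "i < n" "j < n" "i \<noteq> j" for i j
    proof -
      have "x i \<noteq> x j" using xs that by (simp add: x_def n_def nth_eq_iff_index_eq)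
      then have "q \<le> norm (x i - x j)"
        unfolding q_def using that by (intro separation_distance_le) (auto simp: x_def n_def)
      then show ?thesis by simp
    qed
    have E_nonneg: "E \<tau> \<ge> 0"
      unfolding E_def
      by (intro integral_nonneg_AE AE_I2 mult_nonneg_nonneg exponential_sum_sq_nonneg powr_ge_zero)
    have "E (\<sigma> * \<tau>) \<le> C * (min q 1) powr (- (2 * (\<tau> - \<sigma> * \<tau>))) * E \<tau>"
      unfolding E_def using q sep by (intro comparison) auto
    also have "2 * (\<tau> - \<sigma> * \<tau>) = 2 * ?h" by (simp add: algebra_simps)
    also have "C * (min q 1) powr (- (2 * ?h)) * E \<tau> \<le>
        C * ((1 + (?c0\<^sup>2) powr - ?h) * (q\<^sup>2 + ?c0\<^sup>2) powr ?h * q powr (- (2 * ?h))) * E \<tau>"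
      using truncated_distance_powr_le[OF q c0_pos h] C E_nonneg
      by (intro mult_right_mono mult_left_mono) auto
    also have "\<dots> = c * (q\<^sup>2 + ?c0\<^sup>2) powr ?h * q powr (- ((1 - \<sigma>) * 2 * \<tau>)) * E \<tau>"
      by (simp add: c_def mult_ac)
    finally have "s * E (\<sigma> * \<tau>) \<le> s * (c * (q\<^sup>2 + ?c0\<^sup>2) powr ?h * q powr (- ((1 - \<sigma>) * 2 * \<tau>)) * E \<tau>)"
      using s by (rule mult_left_mono)
    moreover have "s * E \<tau> \<le> s * E (\<sigma> * \<tau>)"
      using s bessel_form_antimono[of "\<sigma> * \<tau>" \<tau> n x "vec_index \<alpha>"] \<sigma>\<tau>
      unfolding E_def by (intro mult_left_mono) auto
    moreover have "\<exists>x\<in>set xs. \<exists>z\<in>set xs. q = norm (x - z)" using yz by blast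
    ultimately show ?thesis
      unfolding rq using s E_nonneg by (simp add: mult_ac)
  qed
  have "\<exists>c'>0. \<forall>xs \<alpha>. distinct xs \<and> length xs \<ge> 2 \<and> set xs \<subseteq> \<Omega> \<and>
        \<alpha> \<in> carrier_vec (length xs) \<and> \<alpha> \<noteq> 0\<^sub>v (length xs) \<longrightarrow>
        (let q = separation_distance (set xs);
             A = kernel_matrix k xs; A\<^sub>\<sigma> = kernel_matrix k\<^sub>\<sigma> xs
         in rayleigh_quotient A \<alpha> \<le> rayleigh_quotient A\<^sub>\<sigma> \<alpha> \<and>
            rayleigh_quotient A\<^sub>\<sigma> \<alpha> \<le>
              c' * q powr (- ((1 - \<sigma>) * 2 * \<tau>)) * rayleigh_quotient A \<alpha>)"
    if bdd: "bounded \<Omega>"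
  proof -
    let ?d = "diameter \<Omega>"
    let ?c' = "c * (?d\<^sup>2 + ?c0\<^sup>2) powr ?h"
    have "?d\<^sup>2 + ?c0\<^sup>2 > 0" using c0_pos[where 'd='d] by (intro add_nonneg_pos) auto
    then have "(?d\<^sup>2 + ?c0\<^sup>2) powr ?h > 0" by (simp only: powr_gt_zero less_imp_neq[THEN not_sym] not_False_eq_True)
    with c have c': "?c' > 0" by (rule mult_pos_pos)
    have "rayleigh_quotient (kernel_matrix k xs) \<alpha> \<le> rayleigh_quotient (kernel_matrix k\<^sub>\<sigma> xs) \<alpha> \<and>
      rayleigh_quotient (kernel_matrix k\<^sub>\<sigma> xs) \<alpha> \<le>
        ?c' * separation_distance (set xs) powr (- ((1 - \<sigma>) * 2 * \<tau>)) * rayleigh_quotient (kernel_matrix k xs) \<alpha>"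
      if xs: "distinct xs" "length xs \<ge> 2" "set xs \<subseteq> \<Omega>" and \<alpha>: "\<alpha> \<in> carrier_vec (length xs)" for xs \<alpha>
    proof -
      define q where "q = separation_distance (set xs)"
      let ?R = "rayleigh_quotient (kernel_matrix k xs) \<alpha>"
      note m = main[OF xs(1,2) \<alpha> q_def]
      obtain y z where "y \<in> set xs" "z \<in> set xs" "q = norm (y - z)" using m by blast
      then have "0 \<le> q" "q \<le> ?d"
        using diameter_bounded_bound[OF bdd, of y z] xs(3) by (auto simp: dist_norm)
      then have "(q\<^sup>2 + ?c0\<^sup>2) powr ?h \<le> (?d\<^sup>2 + ?c0\<^sup>2) powr ?h"
        using h by (intro powr_mono2 add_right_mono power_mono) auto
      then have "c * (q\<^sup>2 + ?c0\<^sup>2) powr ?h * q powr (- ((1 - \<sigma>) * 2 * \<tau>)) * ?R \<le>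
          ?c' * q powr (- ((1 - \<sigma>) * 2 * \<tau>)) * ?R"
        using c m by (intro mult_right_mono mult_left_mono) auto
      then show ?thesis using m unfolding q_def by linarith
    qed
    with c' show ?thesis by (intro exI[of _ ?c']) (simp add: Let_def)
  qed
  moreover have "\<exists>c>0. \<forall>xs \<alpha>. distinct xs \<and> length xs \<ge> 2 \<and> set xs \<subseteq> \<Omega> \<and>
        \<alpha> \<in> carrier_vec (length xs) \<and> \<alpha> \<noteq> 0\<^sub>v (length xs) \<longrightarrow>
        (let q = separation_distance (set xs);
             A = kernel_matrix k xs; A\<^sub>\<sigma> = kernel_matrix k\<^sub>\<sigma> xs
         in rayleigh_quotient A \<alpha> \<le> rayleigh_quotient A\<^sub>\<sigma> \<alpha> \<and>
            rayleigh_quotient A\<^sub>\<sigma> \<alpha> \<le>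
              c * (q\<^sup>2 + ?c0\<^sup>2) powr ?h * q powr (- ((1 - \<sigma>) * 2 * \<tau>)) * rayleigh_quotient A \<alpha>)"
    using c main by (intro exI[of _ c]) (simp add: Let_def)
  ultimately show ?thesis using c0_pos[where 'd='d] by blast
qed

end
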